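(* Let $n\ge 2$ and $1\le d<n$. If $f\in C(\mathbb{T}^n)$, then we can construct a sequence of continuous functions from $R_df$ that converges uniformly to $f$. In particular, we can reconstruct $f$ pointwise. If $f\in L^p(\mathbb{T}^n)$, $1\le p<\infty$, then we can reconstruct (from $R_df$) a converging sequence in $L^p$, which has a subsequence that converges to $f$ almost everywhere.
   Context: $\mathbb{T}^n=\mathbb{R}^n/\mathbb{Z}^n$ is the standard flat torus; $\mathcal{T}=C^\infty(\mathbb{T}^n)$ and $\mathcal{T}'$ is its dual, the space of distributions on $\mathbb{T}^n$; $\langle\cdot,\cdot\rangle$ is the duality pairing between $\mathcal{T}'$ and $\mathcal{T}$, extending $\int_{\mathbb{T}^n}f\eta\,dx$, so that $C(\mathbb{T}^n)$ and $L^p(\mathbb{T}^n)$ are subspaces of $\mathcal{T}'$. $G^n_d$ is the set of linearly independent unordered $d$-tuples $A=\{v_1,\dots,v_d\}$ of vectors in $\mathbb{Z}^n\setminus\{0\}$. For $f\in\mathcal{T}$, $x\in\mathbb{T}^n$ and $A\in G^n_d$, the $d$-plane Radon transform is $R_df(x,A)=\int_{[0,1]^d}f(x+t_1v_1+\dots+t_dv_d)\,dt_1\cdots dt_d$. For $f\in\mathcal{T}'$, the distribution $R_df(\cdot,A)\in\mathcal{T}'$ is defined by $\langle R_df(\cdot,A),\eta\rangle=\langle f,R_d\eta(\cdot,A)\rangle$ for all $\eta\in\mathcal{T}$. $R_df$ is regarded as the family $(R_df(\cdot,A))_{A\in G^n_d}$ of distributions on $\mathbb{T}^n$ parametrized by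 $G^n_d$. *)

theory Defs
  imports "HOL-Analysis.Analysis"
begin

text \<open>
  Functions on the flat torus are represented by their lifts, i.e. by functions on
  \<open>real ^ 'n\<close> that are invariant under translation by the integer lattice.
\<close>

definition integer_lattice :: "(real ^ 'n) set" where
  "integer_lattice = {v. \<forall>i. v $ i \<in> \<int>}"

definition torus_periodic :: "(real ^ 'n \<Rightarrow> 'b) \<Rightarrow> bool" where
  "torus_periodic f \<longleftrightarrow> (\<forall>x. \<forall>v\<in>integer_lattice. f (x + v) = f x)"

text \<open>Haar measure of the torus, carried by a fundamental domain (up to a null set).\<close>

definition torus_measure :: "(real ^ 'n) measure" where
  "torus_measure = lebesgue_on (cbox 0 1)"

definition torus_C :: "(real ^ 'n \<Rightarrow> complex) set" where
  "torus_C = {f. torus_periodic f \<and> continuous_on UNIV f}"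

text \<open>Elements are functions, not classes modulo a.e. equality.\<close>

definition torus_Lp :: "real \<Rightarrow> (real ^ 'n \<Rightarrow> complex) set" where
  "torus_Lp p = {f. torus_periodic f \<and> f \<in> borel_measurable torus_measure \<and>
                    integrable torus_measure (\<lambda>x. norm (f x) powr p)}"

primrec iterated_partial :: "'n list \<Rightarrow> (real ^ 'n \<Rightarrow> complex) \<Rightarrow> real ^ 'n \<Rightarrow> complex" where
  "iterated_partial [] f = f"
| "iterated_partial (i # is) f =
     (\<lambda>x. frechet_derivative (iterated_partial is f) (at x) (axis i 1))"

text \<open>Test functions. Differentiability of all iterated partial derivatives includes their
  continuity, hence this is \<open>C\<^sup>\<infinity>\<close>.\<close>

definition torus_test :: "(real ^ 'n \<Rightarrow> complex) set" where
  "torus_test = {\<eta>. torus_periodic \<eta> \<and> (\<forall>is. iterated_partial is \<eta> differentiable_on UNIV)}"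

text \<open>
  Distributions: complex-linear functionals on the test functions that are continuous for the
  Frechet topology given by the seminorms \<open>sup \<bar>\<partial>\<^sup>\<alpha> \<eta>\<bar>\<close>.
  They are \<open>undefined\<close> outside \<open>torus_test\<close>, so that equality of distributions is equality in HOL.
\<close>

type_synonym 'n functional = "(real ^ 'n \<Rightarrow> complex) \<Rightarrow> complex"

definition torus_distributions :: "'n::finite functional set" where
  "torus_distributions = {u \<in> extensional torus_test.
     (\<forall>\<eta>\<in>torus_test. \<forall>\<xi>\<in>torus_test. \<forall>a b.
        u (\<lambda>x. a * \<eta> x + b * \<xi> x) = a * u \<eta> + b * u \<xi>) \<and>
     (\<exists>C m. \<forall>\<eta>\<in>torus_test.
        norm (u \<eta>) \<le> C * (\<Sum>is | length is \<le> m. SUP x. norm (iterated_partial is \<eta> x)))}"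

definition distribution_of :: "(real ^ 'n::finite \<Rightarrow> complex) \<Rightarrow> 'n functional" where
  "distribution_of f = (\<lambda>\<eta>\<in>torus_test. LINT x|torus_measure. f x * \<eta> x)"

definition lattice_frames :: "nat \<Rightarrow> (real ^ 'n) set set" where
  "lattice_frames d = {A. A \<subseteq> integer_lattice - {0} \<and> finite A \<and> card A = d \<and> independent A}"

text \<open>As frames are unordered, the integration cube \<open>[0,1]\<^sup>d\<close> is indexed by the frame itself.\<close>

definition radon_test :: "(real ^ 'n) set \<Rightarrow> (real ^ 'n \<Rightarrow> complex) \<Rightarrow> real ^ 'n \<Rightarrow> complex" where
  "radon_test A f x =
     (LINT t:(\<Pi>\<^sub>E v\<in>A. {0..1})|(\<Pi>\<^sub>M v\<in>A. lborel). f (x + (\<Sum>v\<in>A. t v *\<^sub>R v)))"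

type_synonym 'n radon_data = "(real ^ 'n) set \<Rightarrow> 'n functional"

definition radon :: "nat \<Rightarrow> 'n::finite functional \<Rightarrow> 'n radon_data" where
  "radon d u = (\<lambda>A\<in>lattice_frames d. \<lambda>\<eta>\<in>torus_test. u (radon_test A \<eta>))"

text \<open>
  A construction of a sequence of functions in \<open>X\<close> from Radon data \<open>g\<close>: the \<open>N\<close>-th function is
  obtained from finitely many pairings \<open>\<langle>g(A), \<eta>\<rangle>\<close> as a linear combination of functions in \<open>X\<close>,
  where the frames \<open>A\<close>, the test functions \<open>\<eta>\<close> and the functions combined depend on \<open>N\<close> but not
  on \<open>g\<close>. For an arbitrary map \<open>\<Phi>\<close>, existence would follow by choice from injectivity of the
  transform alone, with constant sequences.
\<close>

definition reconstruction_scheme ::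
  "nat \<Rightarrow> (real ^ 'n \<Rightarrow> complex) set \<Rightarrow> ('n radon_data \<Rightarrow> nat \<Rightarrow> real ^ 'n \<Rightarrow> complex) \<Rightarrow> bool" where
  "reconstruction_scheme d X \<Phi> \<longleftrightarrow>
     (\<forall>N. \<exists>S \<subseteq> lattice_frames d \<times> torus_test \<times> X. finite S \<and>
        (\<forall>g \<in> (\<Pi>\<^sub>E A\<in>lattice_frames d. torus_distributions).
           \<Phi> g N = (\<lambda>x. \<Sum>(A, \<eta>, \<phi>)\<in>S. g A \<eta> * \<phi> x)))"

end

theory Submission
  imports Defs
begin

text \<open>
  The Radon transform along a frame \<open>A\<close> acts on the character \<open>e\<^sub>k(x) = exp (2\<pi>i k\<bullet>x)\<close> as the identity
  whenever all vectors of \<open>A\<close> are orthogonal to \<open>k\<close>. For \<open>d < n\<close> every frequency \<open>k\<close> admits such a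
  frame (\<open>lattice_frame_orthogonal\<close>). By duality, pairing the Radon data of \<open>f\<close> at that frame with
  \<open>e\<^sub>-\<^sub>k\<close> gives the Fourier coefficient of \<open>f\<close> at \<open>k\<close> (\<open>radon_distribution_character\<close>). Every
  trigonometric polynomial obtained from \<open>f\<close> by convolution with a fixed trigonometric polynomial is
  then a fixed finite combination of Radon data (\<open>smoothing_from_radon\<close>).

  It remains to recover \<open>f\<close> from its Fourier coefficients by a summation method. The kernels used are
  the normalized powers of one trigonometric polynomial \<open>bump\<close> with values in \<open>[0, 1]\<close> that is \<open>1\<close>
  exactly on the lattice. They are nonnegative with integral \<open>1\<close> and concentrate at the lattice
  (\<open>kernel_concentrates\<close>), because a power of a number below \<open>r\<close> decays faster than the \<open>N\<close>-th power of
  \<open>r\<close>, which up to a factor bounds the normalizing integral from below. Convolution with them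
  converges uniformly on continuous functions (\<open>smoothing_uniform_limit\<close>).

  On \<open>L\<^sup>p\<close> these convolutions are contractions by Jensen's inequality (\<open>smoothing_Lp_contraction\<close>), and
  the continuous functions are dense (\<open>torus_C_dense_Lp\<close>), which together extend the convergence to
  \<open>L\<^sup>p\<close> (\<open>smoothing_Lp_convergence\<close>). An \<open>L\<^sup>p\<close> convergent sequence has a subsequence that converges
  almost everywhere.
\<close>

section \<open>Characters of the torus\<close>

definition character :: "real ^ 'n \<Rightarrow> real ^ 'n \<Rightarrow> complex" where
  "character k x = cis (2 * pi * (k \<bullet> x))"

lemma norm_character [simp]: "norm (character k x) = 1"
  by (simp add: character_def)

lemma character_0 [simp]: "character 0 x = 1"
  by (simp add: character_def)

lemma character_add_right: "character k (x + y) = character k x * character k y"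
  by (simp add: character_def cis_mult inner_add_right distrib_left)

lemma character_diff_right: "character k (x - y) = character k x * character (- k) y"
  by (simp add: character_def cis_mult inner_diff_right algebra_simps)

lemma character_add_left: "character (k + l) x = character k x * character l x"
  by (simp add: character_def cis_mult inner_add_left distrib_left)

lemma continuous_on_character [continuous_intros]:
  "continuous_on S g \<Longrightarrow> continuous_on S (\<lambda>x. character k (g x))"
  unfolding character_def cis_conv_exp by (intro continuous_intros)

lemma integer_lattice_uminus: "k \<in> integer_lattice \<Longrightarrow> - k \<in> integer_lattice"
  and integer_lattice_add:
    "k \<in> integer_lattice \<Longrightarrow> l \<in> integer_lattice \<Longrightarrow> k + l \<in> integer_lattice"
  and integer_lattice_0: "0 \<in> integer_lattice"
  by (auto simp: integer_lattice_def)

lemma integer_lattice_axis: "c \<in> \<int> \<Longrightarrow> axis i c \<in> integer_lattice"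
  by (auto simp: integer_lattice_def axis_def)

lemma character_periodic:
  assumes "k \<in> integer_lattice" "v \<in> integer_lattice"
  shows "character k (x + v) = character k x"
proof -
  have "k \<bullet> v \<in> \<int>"
    using assms by (auto simp: inner_vec_def integer_lattice_def intro!: Ints_sum Ints_mult)
  then have "character k v = 1"
    by (simp add: character_def cis_multiple_2pi)
  then show ?thesis
    by (simp add: character_add_right)
qed

lemma character_has_derivative:
  "((\<lambda>x. c * character k x) has_derivative
      (\<lambda>h. c * (2 * pi * \<i> * (k \<bullet> h) * character k x))) (at x)"
  unfolding character_def
  by (auto intro!: derivative_eq_intros simp: scaleR_conv_of_real algebra_simps)

text \<open>
  A character is an eigenfunction of every partial derivative, so iterated partials never leave
  the multiples of that one character. This makes characters smooth in the sense of test functions.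
\<close>

lemma iterated_partial_character:
  "\<exists>c'. iterated_partial is (\<lambda>x. c * character k x) = (\<lambda>x. c' * character k x)"
proof (induction "is")
  case Nil
  then show ?case by auto
next
  case (Cons i "is")
  then obtain c' where c': "iterated_partial is (\<lambda>x. c * character k x) = (\<lambda>x. c' * character k x)"
    by blast
  have "iterated_partial (i # is) (\<lambda>x. c * character k x) =
          (\<lambda>x. (c' * (2 * pi * \<i> * (k \<bullet> axis i 1))) * character k x)"
    unfolding iterated_partial.simps c'
    by (simp add: fun_eq_iff frechet_derivative_at[OF character_has_derivative, symmetric])
  then show ?case by blast
qed

lemma character_torus_test:
  assumes "k \<in> integer_lattice"
  shows "character k \<in> torus_test"
proof -
  have "iterated_partial is (character k) differentiable_on UNIV" for "is"
  proof -
    obtain c' where "iterated_partial is (character k) = (\<lambda>x. c' * character k x)"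
      using iterated_partial_character[of "is" 1 k] by auto
    then show ?thesis
      using character_has_derivative[of c' k]
      by (auto simp: differentiable_on_def differentiable_def)
  qed
  then show ?thesis
    using character_periodic[OF assms] by (auto simp: torus_test_def torus_periodic_def)
qed

lemma character_torus_C: "k \<in> integer_lattice \<Longrightarrow> (\<lambda>x. c * character k x) \<in> torus_C"
  using character_periodic by (auto simp: torus_C_def torus_periodic_def intro!: continuous_intros)

lemma integral_cis_unit_interval:
  assumes "m \<in> \<int>"
  shows "(LINT t|lborel. indicator {0..1} t *\<^sub>R cis (2 * pi * m * t)) = (if m = 0 then 1 else 0)"
proof (cases "m = 0")
  case False
  define F where "F t = cis (2 * pi * m * t) / (2 * pi * m * \<i>)" for t
  have "(F has_vector_derivative cis (2 * pi * m * t)) (at t within {0..1})" for t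
    unfolding F_def has_vector_derivative_def using False
    by (auto intro!: derivative_eq_intros simp: fun_eq_iff scaleR_conv_of_real field_simps)
  then have "(LINT t|lborel. indicator {0..1} t *\<^sub>R cis (2 * pi * m * t)) = F 1 - F 0"
    by (intro integral_FTC_Icc) (auto intro!: continuous_intros)
  also have "\<dots> = 0"
    using cis_multiple_2pi[OF assms] by (simp add: F_def)
  finally show ?thesis using False by simp
qed simp

text \<open>
  Over the unit cube the character splits into one factor per coordinate, and a single factor
  \<open>cis (2 * pi * m * t)\<close> with integer \<open>m \<noteq> 0\<close> runs through full periods.
\<close>

lemma integral_character_torus:
  fixes k :: "real ^ 'n::finite"
  assumes "k \<in> integer_lattice"
  shows "(LINT x|torus_measure. character k x) = (if k = 0 then 1 else 0)"
proof -
  interpret lborel_product: product_sigma_finite "\<lambda>_. lborel :: real measure"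
    by unfold_locales
  define u :: "real ^ 'n \<Rightarrow> real \<Rightarrow> complex"
    where "u b t = indicator {0..1} t *\<^sub>R cis (2 * pi * (k \<bullet> b) * t)" for b t
  have u_measurable [measurable]: "u b \<in> borel_measurable borel" for b
  proof -
    have [measurable]: "(\<lambda>t. cis (2 * pi * (k \<bullet> b) * t)) \<in> borel_measurable borel"
      by (intro borel_measurable_continuous_onI continuous_intros)
    show ?thesis unfolding u_def by measurable
  qed
  have cis_sum: "cis (\<Sum>b\<in>B. h b) = (\<Prod>b\<in>B. cis (h b))" if "finite B" for B :: "(real ^ 'n) set" and h
    using that by (induction B) (auto simp: cis_mult[symmetric])
  have ind: "indicator (cbox 0 1) x = (\<Prod>b\<in>Basis. indicator {0..1} (x \<bullet> b) :: real)" for x :: "real ^ 'n"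
  proof -
    have "x \<in> cbox 0 1 \<longleftrightarrow> (\<forall>b\<in>Basis. x \<bullet> b \<in> {0..1})"
      by (auto simp: mem_box Basis_vec_def inner_axis)
    then show ?thesis
      by (auto simp: indicator_def prod_zero_iff)
  qed
  have factor: "indicator (cbox 0 1) x *\<^sub>R character k x = (\<Prod>b\<in>Basis. u b (x \<bullet> b))" for x
  proof -
    have "k \<bullet> x = (\<Sum>b\<in>Basis. (k \<bullet> b) * (x \<bullet> b))"
      by (rule euclidean_inner)
    then show ?thesis
      unfolding character_def u_def ind
      by (simp add: scaleR_conv_of_real prod.distrib cis_sum sum_distrib_left mult.assoc)
  qed
  have "(LINT x|torus_measure. character k x) = (LINT x|lborel. indicator (cbox 0 1) x *\<^sub>R character k x)"
    unfolding torus_measure_def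
    by (subst integral_restrict_space)
       (auto intro!: integral_completion borel_measurable_continuous_onI continuous_intros
          borel_measurable_scaleR borel_measurable_indicator)
  also have "\<dots> = (LINT x|lborel. (\<Prod>b\<in>Basis. u b (x \<bullet> b)))"
    by (simp add: factor)
  also have "\<dots> = (LINT f|(\<Pi>\<^sub>M b\<in>Basis. lborel). (\<Prod>b\<in>Basis. u b (f b)))"
    by (subst lborel_eq, subst integral_distr) (auto)
  also have "\<dots> = (\<Prod>b\<in>Basis. LINT t|lborel. u b t)"
  proof (rule lborel_product.product_integral_prod)
    fix b
    have "continuous_on {0..1} (\<lambda>t. cis (2 * pi * (k \<bullet> b) * t))"
      by (intro continuous_intros)
    then show "integrable lborel (u b)"
      unfolding u_def using borel_integrable_atLeastAtMost'[unfolded set_integrable_def] by blast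
  qed simp
  also have "\<dots> = (\<Prod>b\<in>Basis. if k \<bullet> b = 0 then 1 else 0)"
  proof (rule prod.cong)
    fix b :: "real ^ 'n" assume "b \<in> Basis"
    then have "k \<bullet> b \<in> \<int>"
      using assms by (auto simp: Basis_vec_def inner_axis integer_lattice_def)
    then show "(LINT t|lborel. u b t) = (if k \<bullet> b = 0 then 1 else 0)"
      unfolding u_def by (rule integral_cis_unit_interval)
  qed simp
  also have "\<dots> = (if k = 0 then 1 else 0)"
    by (auto simp: prod_zero_iff euclidean_eq_iff[of k 0])
  finally show ?thesis .
qed

text \<open>
  If the characters agree, the character of \<open>k - l\<close> is constantly \<open>1\<close>, and only the frequency \<open>0\<close>
  has a character with nonzero integral.
\<close>

lemma character_inject:
  fixes k l :: "real ^ 'n::finite"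
  assumes "k \<in> integer_lattice" "l \<in> integer_lattice" "character k = character l"
  shows "k = l"
proof -
  have kl: "k - l \<in> integer_lattice"
    using integer_lattice_add[OF assms(1) integer_lattice_uminus[OF assms(2)]] by simp
  have "character (k - l) x = character (l - l) x" for x
    using assms(3) character_add_left[of k "- l" x] character_add_left[of l "- l" x] by simp
  then have "(LINT x|torus_measure. character (k - l) x) = (LINT x|torus_measure. character (0 :: real ^ 'n) x)"
    by simp
  then have "(if k - l = 0 then 1 else 0 :: complex) = 1"
    unfolding integral_character_torus[OF kl] integral_character_torus[OF integer_lattice_0] by simp
  then show ?thesis by (auto split: if_splits)
qed

section \<open>Radon data of characters\<close>

text \<open>
  This is where \<open>d < n\<close> enters: a frequency leaves \<open>n - 1\<close> independent lattice directions
  orthogonal to it. If \<open>k $ i \<noteq> 0\<close>, the vectors with entry \<open>k $ i\<close> at \<open>j\<close> and \<open>- k $ j\<close> at \<open>i\<close>, for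
  \<open>j \<noteq> i\<close>, are such directions.
\<close>

lemma lattice_frame_orthogonal:
  fixes k :: "real ^ 'n::finite"
  assumes "k \<in> integer_lattice" and "d < CARD('n)"
  obtains A where "A \<in> lattice_frames d" and "\<And>v. v \<in> A \<Longrightarrow> k \<bullet> v = 0"
proof -
  \<comment> \<open>A nonzero coordinate \<open>k $ i\<close> serves as \<open>m\<close>; for \<open>k = 0\<close> any \<open>i\<close> will do, with \<open>m = 1\<close>.\<close>
  obtain i m where m: "m \<in> \<int>" "m \<noteq> 0" "\<And>j. m * (k $ j) = k $ j * k $ i"
  proof (cases "k = 0")
    case True
    then show ?thesis using that[of 1 undefined] by auto
  next
    case False
    then obtain i where "k $ i \<noteq> 0" by (auto simp: vec_eq_iff)
    then show ?thesis using that[of "k $ i" i] assms(1) by (auto simp: integer_lattice_def)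
  qed
  obtain J where J: "J \<subseteq> UNIV - {i}" "card J = d"
    using obtain_subset_with_card_n[of d "UNIV - {i}"] assms(2)
    by (metis UNIV_I card_Diff_singleton less_Suc_eq_le finite_class.finite_UNIV card.remove)
  define v where "v j = axis j m - axis i (k $ j)" for j
  have v_nth: "v j $ l = (if l = j then m else 0)" if "l \<in> J" for j l
    using that J(1) by (auto simp: v_def axis_def)
  have inj: "inj_on v J"
  proof (rule inj_onI)
    fix j l assume "j \<in> J" "l \<in> J" "v j = v l"
    then show "j = l" using v_nth[of j j] v_nth[of j l] m(2) by (auto split: if_splits)
  qed
  have "independent (v ` J)"
  proof (rule independent_if_scalars_zero)
    fix f x assume sum: "(\<Sum>x\<in>v ` J. f x *\<^sub>R x) = 0" and "x \<in> v ` J"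
    then obtain j where j: "j \<in> J" "x = v j" by blast
    have "0 = (\<Sum>l\<in>J. f (v l) *\<^sub>R v l) $ j"
      using sum inj by (simp add: sum.reindex)
    also have "\<dots> = (\<Sum>l\<in>J. if l = j then f (v l) * m else 0)"
      unfolding sum_component using j(1) by (intro sum.cong) (auto simp: v_nth)
    also have "\<dots> = f (v j) * m"
      using j(1) finite_subset[OF J(1)] by (subst sum.delta) auto
    finally show "f x = 0" using j m(2) by simp
  qed simp
  moreover have "v j \<in> integer_lattice - {0}" if "j \<in> J" for j
  proof -
    have "v j \<noteq> 0" using v_nth[OF that, of j] m(2) by auto
    then show ?thesis
      using m(1) assms(1) by (auto simp: v_def integer_lattice_def axis_def)
  qed
  ultimately have "v ` J \<in> lattice_frames d"
    using J(2) inj by (auto simp: lattice_frames_def card_image)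
  moreover have "k \<bullet> v j = 0" for j
    using m(3)[of j] by (simp add: v_def inner_diff_right inner_axis mult.commute)
  ultimately show thesis using that by auto
qed

text \<open>
  Along directions orthogonal to \<open>k\<close> the character is constant, so averaging it over a cell
  spanned by them changes nothing.
\<close>

lemma radon_test_character:
  fixes k :: "real ^ 'n::finite"
  assumes "finite A" and "\<And>v. v \<in> A \<Longrightarrow> k \<bullet> v = 0"
  shows "radon_test A (character k) = character k"
proof
  fix x
  interpret lborel_product: product_sigma_finite "\<lambda>_. lborel :: real measure"
    by unfold_locales
  have "character k (x + (\<Sum>v\<in>A. t v *\<^sub>R v)) = character k x" for t
    by (simp add: character_def inner_add_right inner_sum_right assms(2))
  moreover have "measure (\<Pi>\<^sub>M v\<in>A. lborel) (\<Pi>\<^sub>E v\<in>A. {0..1::real}) = 1"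
    using assms(1) by (simp add: measure_def lborel_product.emeasure_PiM)
  moreover have "emeasure (\<Pi>\<^sub>M v\<in>A. lborel) (\<Pi>\<^sub>E v\<in>A. {0..1::real}) = 1"
    using assms(1) by (simp add: lborel_product.emeasure_PiM)
  ultimately show "radon_test A (character k) x = character k x"
    using assms(1) by (simp add: radon_test_def set_integral_const)
qed

text \<open>
  Hence the Radon data of \<open>f\<close> contain all its Fourier coefficients: for each frequency, use a
  frame orthogonal to it.
\<close>

lemma radon_distribution_character:
  fixes f :: "real ^ 'n::finite \<Rightarrow> complex"
  assumes "A \<in> lattice_frames d" "k \<in> integer_lattice" "\<And>v. v \<in> A \<Longrightarrow> k \<bullet> v = 0"
  shows "radon d (distribution_of f) A (character k) = (LINT x|torus_measure. f x * character k x)"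
proof -
  have "radon_test A (character k) = character k"
    using assms(1,3) by (intro radon_test_character) (auto simp: lattice_frames_def)
  then show ?thesis
    using assms(1) character_torus_test[OF assms(2)] by (simp add: radon_def distribution_of_def)
qed

section \<open>Continuous functions on the torus\<close>

lemma finite_measure_torus: "finite_measure (torus_measure :: (real ^ 'n::finite) measure)"
  using emeasure_bounded_finite[OF bounded_cbox, of "0 :: real ^ 'n" 1]
  by (intro finite_measureI)
     (simp add: torus_measure_def space_restrict_space emeasure_restrict_space less_top)

lemma measure_torus [simp]:
  "measure torus_measure (space (torus_measure :: (real ^ 'n::finite) measure)) = 1"
proof -
  have "(LINT x|torus_measure. character 0 (x :: real ^ 'n)) = 1"
    by (subst integral_character_torus[OF integer_lattice_0]) simp
  then show ?thesis by (simp add: scaleR_conv_of_real)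
qed

lemma torus_C_measurable: "f \<in> torus_C \<Longrightarrow> f \<in> borel_measurable torus_measure"
  unfolding torus_C_def torus_measure_def
  by (auto intro!: measurable_restrict_space1 measurable_completion borel_measurable_continuous_onI)

lemma unit_cube_representative:
  fixes x :: "real ^ 'n::finite"
  obtains v where "v \<in> integer_lattice" and "x + v \<in> cbox 0 1"
proof
  show "(\<chi> i. - of_int \<lfloor>x $ i\<rfloor>) \<in> integer_lattice"
    by (simp add: integer_lattice_def)
  show "x + (\<chi> i. - of_int \<lfloor>x $ i\<rfloor>) \<in> cbox 0 1"
    unfolding mem_box_cart by (auto; linarith)
qed

lemma torus_C_bounded:
  assumes "f \<in> torus_C"
  obtains B where "0 < B" and "\<And>x. norm (f x) \<le> B"
proof -
  have "bounded (f ` cbox 0 1)"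
    using assms by (intro compact_imp_bounded compact_continuous_image)
      (auto simp: torus_C_def intro: continuous_on_subset)
  then obtain B where "0 < B" and B: "\<And>x. x \<in> cbox 0 1 \<Longrightarrow> norm (f x) \<le> B"
    by (auto simp: bounded_pos)
  have "norm (f x) \<le> B" for x
  proof -
    obtain v where "v \<in> integer_lattice" "x + v \<in> cbox 0 1"
      by (rule unit_cube_representative)
    then show ?thesis
      using B[of "x + v"] assms by (simp add: torus_C_def torus_periodic_def)
  qed
  with \<open>0 < B\<close> show thesis by (rule that)
qed

lemma integrable_mult_torus_C:
  assumes "integrable torus_measure h" and "f \<in> torus_C"
  shows "integrable torus_measure (\<lambda>x. h x * f x)"
proof -
  obtain B where B: "0 < B" "\<And>x. norm (f x) \<le> B"
    using torus_C_bounded[OF assms(2)] by blast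
  have "integrable torus_measure (\<lambda>x. of_real B * h x)"
    using assms(1) by (rule integrable_mult_right)
  then show ?thesis
  proof (rule Bochner_Integration.integrable_bound)
    show "(\<lambda>x. h x * f x) \<in> borel_measurable torus_measure"
      using assms torus_C_measurable by (intro borel_measurable_times) auto
    show "AE x in torus_measure. norm (h x * f x) \<le> norm (of_real B * h x)"
      using B by (intro AE_I2) (simp add: norm_mult mult.commute[of "norm (h _)"] mult_right_mono)
  qed
qed

lemma integrable_torus_C:
  assumes "f \<in> torus_C"
  shows "integrable torus_measure f"
proof -
  interpret finite_measure torus_measure by (rule finite_measure_torus)
  obtain B where "0 < B" "\<And>x. norm (f x) \<le> B"
    using torus_C_bounded[OF assms] by blast
  then show ?thesis
    using torus_C_measurable[OF assms] by (intro integrable_const_bound[of _ B]) auto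
qed

lemma torus_C_add: "f \<in> torus_C \<Longrightarrow> g \<in> torus_C \<Longrightarrow> (\<lambda>x. f x + g x) \<in> torus_C"
  by (auto simp: torus_C_def torus_periodic_def intro!: continuous_intros)

lemma torus_C_sum: "(\<And>i. i \<in> I \<Longrightarrow> f i \<in> torus_C) \<Longrightarrow> (\<lambda>x. \<Sum>i\<in>I. f i x) \<in> torus_C"
  by (auto simp: torus_C_def torus_periodic_def intro!: continuous_intros)

lemma torus_C_reflect:
  assumes "f \<in> torus_C"
  shows "(\<lambda>y. f (x - y)) \<in> torus_C"
proof -
  have "f (x - (y + v)) = f (x - y)" if "v \<in> integer_lattice" for y v
    using assms integer_lattice_uminus[OF that]
    by (metis (no_types, lifting) add_uminus_conv_diff diff_diff_eq mem_Collect_eq torus_C_def torus_periodic_def)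
  moreover have "continuous_on UNIV (\<lambda>y. f (x - y))"
  proof (rule continuous_on_compose2[of UNIV f UNIV "\<lambda>y. x - y"])
    show "continuous_on UNIV f" using assms by (simp add: torus_C_def)
  qed (intro continuous_intros | simp)+
  ultimately show ?thesis
    by (auto simp: torus_C_def torus_periodic_def)
qed

section \<open>Trigonometric polynomials\<close>

text \<open>
  Generated by addition, rather than given as finite sums over distinct frequencies, so that
  products need no bookkeeping of colliding frequencies. These are collected in the end, in
  \<open>trig_poly_expansion\<close>.
\<close>

inductive trig_poly :: "(real ^ 'n::finite \<Rightarrow> complex) \<Rightarrow> bool" where
  monomial: "k \<in> integer_lattice \<Longrightarrow> trig_poly (\<lambda>x. c * character k x)"
| add: "trig_poly P \<Longrightarrow> trig_poly Q \<Longrightarrow> trig_poly (\<lambda>x. P x + Q x)"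

lemma trig_poly_const: "trig_poly (\<lambda>x. c)"
  using trig_poly.monomial[OF integer_lattice_0, of c] by simp

lemma trig_poly_torus_C: "trig_poly P \<Longrightarrow> P \<in> torus_C"
  by (induction rule: trig_poly.induct) (auto intro: character_torus_C torus_C_add)

lemma trig_poly_mult:
  assumes "trig_poly P" "trig_poly Q"
  shows "trig_poly (\<lambda>x. P x * Q x)"
  using assms(1)
proof induction
  case (monomial k c)
  from assms(2) show ?case
  proof induction
    case (monomial l c')
    then have "trig_poly (\<lambda>x. (c * c') * character (k + l) x)"
      using \<open>k \<in> integer_lattice\<close> by (intro trig_poly.monomial integer_lattice_add)
    then show ?case by (simp add: character_add_left mult_ac)
  next
    case (add Q Q')
    then show ?case using trig_poly.add by (auto simp: distrib_left)
  qed
next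
  case (add P P')
  then show ?case using trig_poly.add by (auto simp: distrib_right)
qed

lemma trig_poly_power: "trig_poly P \<Longrightarrow> trig_poly (\<lambda>x. P x ^ m)"
  by (induction m) (auto intro: trig_poly_const trig_poly_mult)

lemma trig_poly_sum: "finite I \<Longrightarrow> (\<And>i. i \<in> I \<Longrightarrow> trig_poly (P i)) \<Longrightarrow> trig_poly (\<lambda>x. \<Sum>i\<in>I. P i x)"
  by (induction I rule: finite_induct) (auto intro: trig_poly_const trig_poly.add)

text \<open>
  Distinct frequencies give distinct test functions. A reconstruction scheme sums over a finite
  set of triples, in which equal terms would be merged.
\<close>

lemma trig_poly_expansion:
  assumes "trig_poly P"
  obtains F c where "finite F" "F \<subseteq> integer_lattice" "P = (\<lambda>x. \<Sum>k\<in>F. c k * character k x)"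
proof -
  have "\<exists>F c. finite F \<and> F \<subseteq> integer_lattice \<and> P = (\<lambda>x. \<Sum>k\<in>F. c k * character k x)"
    using assms
  proof induction
    case (monomial k c)
    then show ?case by (intro exI[of _ "{k}"] exI[of _ "\<lambda>_. c"]) auto
  next
    case (add P Q)
    then obtain F c G b where F: "finite F" "F \<subseteq> integer_lattice" "P = (\<lambda>x. \<Sum>k\<in>F. c k * character k x)"
      and G: "finite G" "G \<subseteq> integer_lattice" "Q = (\<lambda>x. \<Sum>k\<in>G. b k * character k x)"
      by blast
    define a where "a k = (if k \<in> F then c k else 0) + (if k \<in> G then b k else 0)" for k
    have "P x = (\<Sum>k\<in>F \<union> G. (if k \<in> F then c k else 0) * character k x)"
      and "Q x = (\<Sum>k\<in>F \<union> G. (if k \<in> G then b k else 0) * character k x)" for x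
      unfolding F(3) G(3) using F(1) G(1) by (auto intro!: sum.mono_neutral_cong_left)
    then have "P x + Q x = (\<Sum>k\<in>F \<union> G. a k * character k x)" for x
      by (simp add: a_def distrib_right sum.distrib)
    then show ?case using F(1,2) G(1,2) by (intro exI[of _ "F \<union> G"] exI[of _ a]) auto
  qed
  then show thesis using that by blast
qed

text \<open>
  Invariance of Haar measure under \<open>y \<mapsto> x - y\<close>. For a trigonometric polynomial it is a
  consequence of orthogonality, since both integrals pick out the zeroth coefficient, without any
  cutting and translating of fundamental domains.
\<close>

lemma integral_trig_poly_reflect:
  assumes "trig_poly P"
  shows "(LINT y|torus_measure. P (x - y)) = (LINT y|torus_measure. P y)"
  using assms
proof induction
  case (monomial k c)
  have "(LINT y|torus_measure. c * character k (x - y)) = c * character k x * (if k = 0 then 1 else 0)"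
  proof -
    have "c * character k (x - y) = c * character k x * character (- k) y" for y
      by (simp add: character_diff_right)
    then show ?thesis
      by (simp only: integral_mult_right_zero neg_equal_0_iff_equal
          integral_character_torus[OF integer_lattice_uminus[OF monomial]])
  qed
  also have "\<dots> = c * (if k = 0 then 1 else 0)"
    by simp
  also have "\<dots> = (LINT y|torus_measure. c * character k y)"
    by (simp only: integral_mult_right_zero integral_character_torus[OF monomial])
  finally show ?case .
next
  case (add P Q)
  note PQ = add.hyps[THEN trig_poly_torus_C]
  show ?case
    using add.IH PQ[THEN integrable_torus_C] PQ[THEN torus_C_reflect, THEN integrable_torus_C]
    by simp
qed

text \<open>
  Fubini and translation invariance combined; for a trigonometric polynomial \<open>P\<close> the inner
  integral is again one, with zeroth coefficient the product of those of \<open>h\<close> and \<open>P\<close>.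
\<close>

lemma integral_trig_poly_convolution:
  assumes "trig_poly P" and h: "integrable torus_measure h"
  shows "integrable torus_measure (\<lambda>x. LINT y|torus_measure. h y * P (x - y))"
    and "(LINT x|torus_measure. LINT y|torus_measure. h y * P (x - y)) =
           (LINT y|torus_measure. h y) * (LINT y|torus_measure. P y)"
proof -
  have "integrable torus_measure (\<lambda>x. LINT y|torus_measure. h y * P (x - y)) \<and>
        (LINT x|torus_measure. LINT y|torus_measure. h y * P (x - y)) =
           (LINT y|torus_measure. h y) * (LINT y|torus_measure. P y)"
    using assms(1)
  proof induction
    case (monomial k c)
    have eq: "(LINT y|torus_measure. h y * (c * character k (x - y))) =
                (LINT y|torus_measure. h y * character (- k) y) * (c * character k x)" for x
    proof -
      have "h y * (c * character k (x - y)) = h y * character (- k) y * (c * character k x)" for y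
        by (simp add: character_diff_right mult_ac)
      then show ?thesis by (simp only: integral_mult_left_zero)
    qed
    show ?case
    proof (intro conjI)
      show "integrable torus_measure (\<lambda>x. LINT y|torus_measure. h y * (c * character k (x - y)))"
        unfolding eq by (intro integrable_mult_right integrable_torus_C character_torus_C monomial)
      show "(LINT x|torus_measure. LINT y|torus_measure. h y * (c * character k (x - y))) =
              (LINT y|torus_measure. h y) * (LINT y|torus_measure. c * character k y)"
        by (simp only: eq integral_mult_right_zero integral_character_torus[OF monomial]) simp
    qed
  next
    case (add P Q)
    have eq: "(LINT y|torus_measure. h y * (P (x - y) + Q (x - y))) =
        (LINT y|torus_measure. h y * P (x - y)) + (LINT y|torus_measure. h y * Q (x - y))" for x
      unfolding distrib_left
      by (intro Bochner_Integration.integral_add integrable_mult_torus_C h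
          add.hyps[THEN trig_poly_torus_C, THEN torus_C_reflect])
    show ?case
      unfolding eq using add.IH add.hyps[THEN trig_poly_torus_C, THEN integrable_torus_C]
      by (simp add: distrib_left)
  qed
  then show "integrable torus_measure (\<lambda>x. LINT y|torus_measure. h y * P (x - y))"
    and "(LINT x|torus_measure. LINT y|torus_measure. h y * P (x - y)) =
           (LINT y|torus_measure. h y) * (LINT y|torus_measure. P y)"
    by auto
qed

section \<open>An approximate identity of trigonometric polynomials\<close>

text \<open>
  A trigonometric polynomial with values in \<open>[0, 1]\<close> that takes the value \<open>1\<close> exactly on the
  lattice. Its normalized powers serve as approximate identity in place of the Fejer kernel: they
  are nonnegative, and they concentrate at the lattice because the bump is continuous.
\<close>

definition bump :: "real ^ 'n::finite \<Rightarrow> real" where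
  "bump x = (\<Sum>i\<in>UNIV. (1 + cos (2 * pi * x $ i)) / 2) / CARD('n)"

lemma bump_nonneg: "0 \<le> bump x"
proof -
  have "0 \<le> 1 + cos t" for t :: real
    using cos_ge_minus_one[of t] by linarith
  then show ?thesis
    unfolding bump_def by (intro divide_nonneg_nonneg sum_nonneg) auto
qed

lemma bump_0: "bump 0 = 1"
  by (simp add: bump_def)

lemma continuous_on_bump: "continuous_on UNIV bump"
  unfolding bump_def by (intro continuous_intros) auto

lemma trig_poly_bump: "trig_poly (\<lambda>x :: real ^ 'n::finite. complex_of_real (bump x))"
proof -
  have cos_eq: "complex_of_real (cos (2 * pi * x $ i)) =
      1 / 2 * character (axis i 1) x + 1 / 2 * character (- axis i 1) x" for x :: "real ^ 'n" and i
    by (simp add: character_def complex_eq_iff inner_axis inner_commute[of "axis _ _"])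
  have "trig_poly (\<lambda>x :: real ^ 'n. \<Sum>i\<in>UNIV. 1 / (2 * CARD('n)) +
      1 / (2 * CARD('n)) * (1 / 2 * character (axis i 1) x + 1 / 2 * character (- axis i 1) x))"
    by (intro trig_poly_sum trig_poly.add trig_poly_mult trig_poly_const trig_poly.monomial
        integer_lattice_uminus integer_lattice_axis) auto
  also have "(\<lambda>x :: real ^ 'n. \<Sum>i\<in>UNIV. 1 / (2 * CARD('n)) +
      1 / (2 * CARD('n)) * (1 / 2 * character (axis i 1) x + 1 / 2 * character (- axis i 1) x)) =
      (\<lambda>x. complex_of_real (bump x))"
    unfolding cos_eq[symmetric]
    by (simp add: fun_eq_iff bump_def sum_divide_distrib add_divide_distrib)
  finally show ?thesis .
qed

text \<open>
  An average of numbers in \<open>[0, 1]\<close> is close to \<open>1\<close> only if each of them is.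
\<close>

lemma bump_gt_imp_near_lattice:
  fixes \<delta> :: real
  assumes "0 < \<delta>"
  obtains q where "0 < q" "q < 1"
    and "\<And>z :: real ^ 'n::finite. q < bump z \<Longrightarrow> \<exists>v\<in>integer_lattice. norm (z - v) < \<delta>"
proof -
  define n where "n = real CARD('n)"
  have n: "1 \<le> n"
    unfolding n_def by (metis One_nat_def Suc_leI of_nat_1 of_nat_le_iff zero_less_card_finite)
  define r where "r = min (\<delta> / n) (1 / 2)"
  have r: "0 < r" "r \<le> 1 / 2" "n * r \<le> \<delta>"
    using assms n by (auto simp: r_def field_simps min_def)
  \<comment> \<open>The bump's value when one coordinate is at distance \<open>r\<close> from the integers and all others
      are integers: a single bad coordinate already pushes the bump down to \<open>q\<close>.\<close>
  define q where "q = 1 - (1 - cos (2 * pi * r)) / (2 * n)"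
  have cos_r: "cos (2 * pi * r) < 1"
    using cos_monotone_0_pi[of 0 "2 * pi * r"] r by simp
  show thesis
  proof
    \<comment> \<open>For \<open>n = 1\<close> and \<open>r = 1 / 2\<close> the number \<open>q\<close> is \<open>0\<close>, hence the maximum.\<close>
    show "0 < max q (1/2)" by simp
    show "max q (1/2) < 1" using cos_r n by (simp add: q_def)
    fix z :: "real ^ 'n" assume z: "max q (1/2) < bump z"
    define v :: "real ^ 'n" where "v = (\<chi> i. of_int (round (z $ i)))"
    have "\<bar>z $ i - v $ i\<bar> < r" for i
    proof (rule ccontr)
      define w where "w = \<bar>z $ i - v $ i\<bar>"
      assume "\<not> \<bar>z $ i - v $ i\<bar> < r"
      then have w: "r \<le> w" "w \<le> 1 / 2"
        using of_int_round_abs_le[of "z $ i"] by (auto simp: w_def v_def abs_minus_commute)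
      have "cos (2 * pi * z $ i) = cos (2 * pi * z $ i - 2 * pi * v $ i)"
        using sin_int_2pin cos_int_2pin by (simp add: cos_diff v_def mult.assoc)
      also have "\<dots> = cos (2 * pi * w)"
        unfolding w_def by (simp add: abs_if flip: right_diff_distrib) (metis cos_minus minus_diff_eq mult_minus_right)
      also have "\<dots> \<le> cos (2 * pi * r)"
        using w r by (intro cos_monotone_0_pi_le) auto
      finally have "1 - cos (2 * pi * r) \<le> 1 - cos (2 * pi * z $ i)" by simp
      also have "\<dots> \<le> (\<Sum>j\<in>UNIV. 1 - cos (2 * pi * z $ j))"
        by (rule member_le_sum) auto
      also have "\<dots> = 2 * n * (1 - bump z)"
        using n by (simp add: bump_def n_def sum_subtractf sum.distrib sum_divide_distrib[symmetric] field_simps)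
      also have "\<dots> < 2 * n * (1 - q)"
        using z n by auto
      also have "\<dots> = 1 - cos (2 * pi * r)"
        using n by (simp add: q_def)
      finally show False by simp
    qed
    then have "(\<Sum>i\<in>UNIV. \<bar>(z - v) $ i\<bar>) < (\<Sum>i\<in>(UNIV :: 'n set). r)"
      by (intro sum_strict_mono) auto
    then have "norm (z - v) < n * r"
      using norm_le_l1_cart[of "z - v"] by (simp add: n_def)
    moreover have "v \<in> integer_lattice"
      by (simp add: v_def integer_lattice_def)
    ultimately show "\<exists>v\<in>integer_lattice. norm (z - v) < \<delta>"
      using r(3) by force
  qed
qed

definition bump_kernel :: "nat \<Rightarrow> real ^ 'n::finite \<Rightarrow> real" where
  "bump_kernel N x = bump x ^ N / (LINT y|torus_measure. bump (y :: real ^ 'n) ^ N)"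

text \<open>
  The value at \<open>0\<close> is \<open>1\<close>, and \<open>0\<close> is a corner of the unit cube, so that the superlevel set
  meets the interior of the cube in a nonempty open set.
\<close>

lemma bump_superlevel_measure_pos:
  assumes "q < 1"
  shows "0 < measure torus_measure {x \<in> space torus_measure. q < bump (x :: real ^ 'n::finite)}"
proof -
  let ?U = "{x :: real ^ 'n. q < bump x}"
  have U: "open ?U"
    using continuous_on_bump by (intro open_Collect_less continuous_on_const)
  have "(\<chi> i. 1 / 2) \<in> box (0 :: real ^ 'n) 1"
    by (simp add: mem_box_cart)
  then have "closure (box 0 1) = cbox (0 :: real ^ 'n) 1"
    by (intro closure_box) blast
  moreover have "0 \<in> ?U \<inter> cbox 0 1"
    using assms by (simp add: bump_0 mem_box_cart)
  ultimately have "?U \<inter> box 0 1 \<noteq> {}"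
    using open_Int_closure_eq_empty[OF U, of "box 0 1"] by auto
  then have "\<not> negligible (?U \<inter> box 0 1)"
    using U by (intro open_not_negligible open_Int open_box)
  then have "\<not> negligible (?U \<inter> cbox 0 1)"
    by (rule contrapos_nn) (erule negligible_subset, use box_subset_cbox in blast)
  moreover have "?U \<inter> cbox 0 1 \<in> lmeasurable"
  proof (rule bounded_set_imp_lmeasurable)
    show "bounded (?U \<inter> cbox 0 1)"
      by (rule bounded_subset[OF bounded_cbox]) blast
    show "?U \<inter> cbox 0 1 \<in> sets lebesgue"
      using U by (simp add: sets.Int borel_open)
  qed
  ultimately have "measure lebesgue (?U \<inter> cbox 0 1) \<noteq> 0"
    by (simp add: negligible_iff_measure)
  moreover have "{x \<in> space torus_measure. q < bump x} = ?U \<inter> cbox 0 1"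
    by (auto simp: torus_measure_def)
  ultimately show ?thesis
    by (simp add: torus_measure_def measure_restrict_space zero_less_measure_iff)
qed

lemma integrable_bump_power: "integrable torus_measure (\<lambda>x. bump x ^ N)"
proof -
  have "integrable torus_measure (\<lambda>x. complex_of_real (bump x) ^ N)"
    by (intro integrable_torus_C trig_poly_torus_C trig_poly_power trig_poly_bump)
  then show ?thesis
    unfolding of_real_power[symmetric] by (rule complex_of_real_integrable_eq[THEN iffD1]) 
qed

text \<open>
  Markov's inequality for the \<open>N\<close>-th power.
\<close>

lemma bump_power_integral_lower_bound:
  assumes "0 < q"
  shows "q ^ N * measure torus_measure {x \<in> space torus_measure. q < bump (x :: real ^ 'n::finite)}
           \<le> (LINT y|torus_measure. bump (y :: real ^ 'n) ^ N)"
proof -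
  let ?S = "{x \<in> space torus_measure. q < bump (x :: real ^ 'n)}"
  interpret finite_measure "torus_measure :: (real ^ 'n) measure" by (rule finite_measure_torus)
  have [measurable]: "bump \<in> borel_measurable (torus_measure :: (real ^ 'n) measure)"
    using borel_measurable_integrable[OF integrable_bump_power[of 1]] by simp
  have S: "?S \<in> sets torus_measure"
    by measurable
  have "q ^ N * measure torus_measure ?S = (LINT x|torus_measure. q ^ N * indicator ?S x)"
    using S by simp
  also have "\<dots> \<le> (LINT y|torus_measure. bump (y :: real ^ 'n) ^ N)"
  proof (rule integral_mono)
    show "integrable torus_measure (\<lambda>x :: real ^ 'n. q ^ N * indicator ?S x)"
      using S by (intro integrable_mult_right integrable_real_indicator emeasure_finite)
        (simp_all add: less_top[symmetric])
    show "q ^ N * indicator ?S x \<le> bump x ^ N" for x :: "real ^ 'n"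
      using assms bump_nonneg[of x] by (auto simp: indicator_def intro!: power_mono)
  qed (rule integrable_bump_power)
  finally show ?thesis .
qed

lemma bump_power_integral_pos: "0 < (LINT y|torus_measure. bump (y :: real ^ 'n::finite) ^ N)"
proof -
  have "0 < (1 / 2) ^ N * measure torus_measure {x \<in> space torus_measure. 1 / 2 < bump (x :: real ^ 'n)}"
    by (intro mult_pos_pos bump_superlevel_measure_pos) auto
  then show ?thesis
    using bump_power_integral_lower_bound[where 'n = 'n, of "1 / 2" N] by simp
qed

lemma kernel_nonneg: "0 \<le> bump_kernel N (x :: real ^ 'n::finite)"
  using bump_power_integral_pos[where 'n = 'n, of N] bump_nonneg[of x]
  by (simp add: bump_kernel_def less_imp_le)

lemma trig_poly_kernel: "trig_poly (\<lambda>x. complex_of_real (bump_kernel N x))"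
  using trig_poly_mult[OF trig_poly_power[OF trig_poly_bump, of N] trig_poly_const]
  by (simp add: bump_kernel_def divide_inverse)

lemma integral_kernel: "(LINT y|torus_measure. bump_kernel N (x - y :: real ^ 'n::finite)) = 1"
proof -
  have "complex_of_real (LINT y|torus_measure. bump_kernel N (x - y)) =
          (LINT y|torus_measure. complex_of_real (bump_kernel N (y :: real ^ 'n)))"
    using integral_trig_poly_reflect[OF trig_poly_kernel, of N x] by simp
  also have "\<dots> = 1"
    using bump_power_integral_pos[where 'n = 'n, of N]
    by (simp only: integral_complex_of_real) (simp add: bump_kernel_def)
  finally show ?thesis by simp
qed

text \<open>
  Take \<open>r\<close> between \<open>q\<close> and \<open>1\<close>. Where the bump is at most \<open>q\<close>, its power is at most
  \<open>q ^ N\<close>, whereas the normalizing integral is at least a positive multiple of \<open>r ^ N\<close>.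
\<close>

lemma kernel_concentrates:
  assumes "0 < q" "q < 1" "0 < \<epsilon>"
  shows "\<forall>\<^sub>F N in sequentially. \<forall>z :: real ^ 'n::finite. bump z \<le> q \<longrightarrow> bump_kernel N z < \<epsilon>"
proof -
  define r where "r = (q + 1) / 2"
  define m where "m = measure torus_measure {x \<in> space torus_measure. r < bump (x :: real ^ 'n)}"
  have r: "q < r" "r < 1" "0 < r" using assms by (auto simp: r_def)
  have m: "0 < m" unfolding m_def by (rule bump_superlevel_measure_pos) fact
  have "(\<lambda>N. (q / r) ^ N) \<longlonglongrightarrow> 0"
    using r assms by (intro LIMSEQ_power_zero) auto
  then have "\<forall>\<^sub>F N in sequentially. (q / r) ^ N < \<epsilon> * m"
    using assms m by (intro order_tendstoD) auto
  then show ?thesis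
  proof eventually_elim
    case (elim N)
    have "bump_kernel N z < \<epsilon>" if "bump z \<le> q" for z :: "real ^ 'n"
    proof -
      have "bump_kernel N z \<le> q ^ N / (r ^ N * m)"
        unfolding bump_kernel_def m_def using r m bump_nonneg[of z] that
        by (intro frac_le power_mono bump_power_integral_lower_bound) (auto simp: m_def)
      also have "\<dots> < \<epsilon>"
        using elim m r by (simp add: power_divide field_simps)
      finally show ?thesis .
    qed
    then show ?case by blast
  qed
qed

section \<open>Smoothing of continuous functions\<close>

text \<open>
  Uniform continuity, with closeness on the torus measured by the bump: if \<open>bump (x - y)\<close> is near
  \<open>1\<close>, then lattice translations bring \<open>x\<close> and \<open>y\<close> close to each other and into a compact
  neighbourhood of the unit cube.
\<close>

lemma torus_C_modulus:
  assumes f: "f \<in> torus_C" and "0 < \<epsilon>"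
  obtains q where "0 < q" "q < 1"
    and "\<And>x y :: real ^ 'n::finite. q < bump (x - y) \<Longrightarrow> norm (f x - f y) < \<epsilon>"
proof -
  define K :: "(real ^ 'n) set" where "K = {x + w |x w. x \<in> cbox 0 1 \<and> w \<in> cball 0 1}"
  have "compact K"
    unfolding K_def by (intro compact_sums compact_cbox compact_cball)
  moreover have "continuous_on K f"
    using f by (auto simp: torus_C_def intro: continuous_on_subset)
  ultimately have "uniformly_continuous_on K f"
    by (intro compact_uniformly_continuous)
  then obtain \<delta> where \<delta>: "0 < \<delta>"
      "\<And>x y. x \<in> K \<Longrightarrow> y \<in> K \<Longrightarrow> dist x y < \<delta> \<Longrightarrow> dist (f x) (f y) < \<epsilon>"
    using \<open>0 < \<epsilon>\<close> unfolding uniformly_continuous_on_def by metis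
  obtain q where q: "0 < q" "q < 1"
      "\<And>z :: real ^ 'n. q < bump z \<Longrightarrow> \<exists>v\<in>integer_lattice. norm (z - v) < min \<delta> 1"
    using bump_gt_imp_near_lattice[of "min \<delta> 1"] \<delta>(1) by auto
  have "norm (f x - f y) < \<epsilon>" if xy: "q < bump (x - y)" for x y :: "real ^ 'n"
  proof -
    obtain v where v: "v \<in> integer_lattice" "norm (x - y - v) < min \<delta> 1"
      using q(3)[OF xy] by blast
    obtain u where u: "u \<in> integer_lattice" "y + u \<in> cbox 0 1"
      by (rule unit_cube_representative)
    have "x + (u - v) = (y + u) + (x - y - v)" "x - y - v \<in> cball 0 1"
      using v(2) by auto
    with u(2) have "x + (u - v) \<in> K"
      unfolding K_def by blast
    moreover have "y + u \<in> K"
    proof -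
      have "y + u = (y + u) + 0" "0 \<in> cball (0 :: real ^ 'n) 1" by auto
      with u(2) show ?thesis unfolding K_def by blast
    qed
    moreover have "dist (x + (u - v)) (y + u) < \<delta>"
      using v(2) by (simp add: dist_norm algebra_simps)
    ultimately have "dist (f (x + (u - v))) (f (y + u)) < \<epsilon>"
      by (rule \<delta>(2))
    moreover have "u - v \<in> integer_lattice"
      using integer_lattice_add[OF u(1) integer_lattice_uminus[OF v(1)]] by simp
    ultimately show ?thesis
      using f u(1) by (simp add: dist_norm torus_C_def torus_periodic_def)
  qed
  with q(1,2) show thesis by (rule that)
qed

definition smoothing :: "nat \<Rightarrow> (real ^ 'n::finite \<Rightarrow> complex) \<Rightarrow> real ^ 'n \<Rightarrow> complex" where
  "smoothing N f x = (LINT y|torus_measure. f y * bump_kernel N (x - y))"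

lemma kernel_torus_C: "(\<lambda>y. complex_of_real (bump_kernel N (x - y))) \<in> torus_C"
  by (rule torus_C_reflect[OF trig_poly_torus_C[OF trig_poly_kernel], of N x])

lemma integrable_kernel: "integrable torus_measure (\<lambda>y. bump_kernel N (x - y))"
  using integrable_torus_C[OF kernel_torus_C] by (simp add: complex_of_real_integrable_eq)

text \<open>
  The difference \<open>smoothing N f x - f x\<close> is the mean of \<open>f y - f x\<close> against the kernel. Where
  the bump exceeds \<open>q\<close> the oscillation of \<open>f\<close> is small; elsewhere the kernel is.
\<close>

lemma smoothing_uniform_limit:
  fixes f :: "real ^ 'n::finite \<Rightarrow> complex"
  assumes f: "f \<in> torus_C"
  shows "uniform_limit UNIV (\<lambda>N. smoothing N f) f sequentially"
proof (rule uniform_limitI)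
  fix \<epsilon> :: real assume "0 < \<epsilon>"
  obtain B where B: "0 < B" "\<And>x. norm (f x) \<le> B"
    using torus_C_bounded[OF f] by blast
  obtain q where q: "0 < q" "q < 1" "\<And>x y. q < bump (x - y) \<Longrightarrow> norm (f x - f y) < \<epsilon> / 2"
    using torus_C_modulus[OF f, of "\<epsilon> / 2"] \<open>0 < \<epsilon>\<close> by auto
  \<comment> \<open>Where the kernel is below \<open>\<eta>\<close>, the integrand is at most \<open>2 * B * \<eta> = \<epsilon> / 4\<close>.\<close>
  define \<eta> where "\<eta> = \<epsilon> / (8 * B)"
  have "0 < \<eta>" using \<open>0 < \<epsilon>\<close> B(1) by (simp add: \<eta>_def)
  from kernel_concentrates[where 'n = 'n, OF q(1,2) this]
  show "\<forall>\<^sub>F N in sequentially. \<forall>x\<in>UNIV. dist (smoothing N f x) (f x) < \<epsilon>"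
  proof eventually_elim
    case (elim N)
    have "dist (smoothing N f x) (f x) < \<epsilon>" for x
    proof -
      have pointwise: "norm ((f y - f x) * bump_kernel N (x - y)) \<le> \<epsilon> / 2 * bump_kernel N (x - y) + 2 * B * \<eta>" for y
      proof (cases "q < bump (x - y)")
        case True
        then have "norm (f y - f x) * bump_kernel N (x - y) \<le> \<epsilon> / 2 * bump_kernel N (x - y)"
          using q(3)[of x y] kernel_nonneg by (intro mult_right_mono) (auto simp: norm_minus_commute)
        then show ?thesis
          using B(1) \<open>0 < \<eta>\<close> kernel_nonneg[of N "x - y"] by (simp add: norm_mult add_increasing2)
      next
        case False
        then have "norm (f y - f x) * bump_kernel N (x - y) \<le> (B + B) * \<eta>"
          using elim B(1) kernel_nonneg[of N "x - y"] 
          by (intro mult_mono order.trans[OF norm_triangle_ineq4] add_mono B(2)) (auto simp: less_imp_le)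
        then show ?thesis
          using \<open>0 < \<epsilon>\<close> kernel_nonneg[of N "x - y"] by (simp add: norm_mult add_increasing)
      qed
      have int_f: "integrable torus_measure (\<lambda>y. f y * bump_kernel N (x - y))"
        by (intro integrable_mult_torus_C integrable_torus_C f kernel_torus_C)
      have int_K: "integrable torus_measure (\<lambda>y. f x * bump_kernel N (x - y))"
        by (intro integrable_mult_right integrable_torus_C kernel_torus_C)
      have int_diff: "integrable torus_measure (\<lambda>y. (f y - f x) * bump_kernel N (x - y))"
        unfolding left_diff_distrib using int_f int_K by (rule Bochner_Integration.integrable_diff)
      have "(LINT y|torus_measure. complex_of_real (bump_kernel N (x - y))) = 1"
        by (simp only: integral_complex_of_real integral_kernel of_real_1)
      then have "smoothing N f x - f x = (LINT y|torus_measure. (f y - f x) * bump_kernel N (x - y))"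
        unfolding left_diff_distrib smoothing_def Bochner_Integration.integral_diff[OF int_f int_K]
        by simp
      then have "norm (smoothing N f x - f x) \<le>
          (LINT y|torus_measure. norm ((f y - f x) * bump_kernel N (x - y)))"
        by simp
      also have "\<dots> \<le> (LINT y|torus_measure. \<epsilon> / 2 * bump_kernel N (x - y) + 2 * B * \<eta>)"
      proof (rule integral_mono)
        interpret finite_measure "torus_measure :: (real ^ 'n) measure" by (rule finite_measure_torus)
        show "integrable torus_measure (\<lambda>y. \<epsilon> / 2 * bump_kernel N (x - y) + 2 * B * \<eta>)"
          by (intro Bochner_Integration.integrable_add integrable_mult_right integrable_kernel integrable_const)
      qed (use int_diff pointwise in auto)
      also have "\<dots> = \<epsilon> / 2 + 2 * B * \<eta>"
      proof -
        interpret finite_measure "torus_measure :: (real ^ 'n) measure" by (rule finite_measure_torus)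
        show ?thesis by (simp add: integrable_kernel integral_kernel)
      qed
      also have "\<dots> < \<epsilon>"
        using B(1) \<open>0 < \<epsilon>\<close> by (simp add: \<eta>_def)
      finally show ?thesis by (simp add: dist_norm)
    qed
    then show ?case by blast
  qed
qed

section \<open>The spaces \<open>L\<^sup>p\<close> of the torus\<close>

lemma torus_C_subset_Lp: "f \<in> torus_C \<Longrightarrow> 0 \<le> p \<Longrightarrow> f \<in> torus_Lp p"
  for f :: "real ^ 'n::finite \<Rightarrow> complex"
proof -
  assume f: "f \<in> torus_C" and "0 \<le> p"
  interpret finite_measure "torus_measure :: (real ^ 'n) measure" by (rule finite_measure_torus)
  obtain B where "0 < B" "\<And>x. norm (f x) \<le> B"
    using torus_C_bounded[OF f] by blast
  then have "integrable torus_measure (\<lambda>x. norm (f x) powr p)"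
    using torus_C_measurable[OF f] \<open>0 \<le> p\<close>
    by (intro integrable_const_bound[of _ "B powr p"]) (auto intro!: AE_I2 powr_mono2)
  then show "f \<in> torus_Lp p"
    using f torus_C_measurable[OF f] by (simp add: torus_Lp_def torus_C_def)
qed

lemma torus_Lp_integrable:
  fixes f :: "real ^ 'n::finite \<Rightarrow> complex"
  assumes f: "f \<in> torus_Lp p" and "1 \<le> p"
  shows "integrable torus_measure f"
proof -
  interpret finite_measure "torus_measure :: (real ^ 'n) measure" by (rule finite_measure_torus)
  have le: "t \<le> 1 + t powr p" if "0 \<le> t" for t :: real
  proof (cases "t \<le> 1")
    case False
    then have "t powr 1 \<le> t powr p" using \<open>1 \<le> p\<close> by (intro powr_mono) auto
    then show ?thesis using False by simp
  qed (simp add: add_increasing2)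
  have "integrable torus_measure (\<lambda>x. 1 + norm (f x) powr p)"
    using f by (intro Bochner_Integration.integrable_add integrable_const) (simp add: torus_Lp_def)
  then show ?thesis
  proof (rule Bochner_Integration.integrable_bound)
    show "f \<in> borel_measurable torus_measure"
      using f by (simp add: torus_Lp_def)
    show "AE x in torus_measure. norm (f x) \<le> norm (1 + norm (f x) powr p)"
    proof (rule AE_I2)
      show "norm (f x) \<le> norm (1 + norm (f x) powr p)" for x
        using le[of "norm (f x)"] by simp
    qed
  qed
qed

text \<open>
  This replaces Minkowski's inequality: the factor \<open>2 powr p\<close> is harmless because only smallness
  of \<open>L\<^sup>p\<close> distances matters.
\<close>

lemma norm_add_powr_le:
  assumes "0 \<le> p"
  shows "norm (a + b :: complex) powr p \<le> 2 powr p * (norm a powr p + norm b powr p)"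
proof -
  have "norm (a + b) powr p \<le> (2 * max (norm a) (norm b)) powr p"
    using assms by (intro powr_mono2) (auto intro: order.trans[OF norm_triangle_ineq])
  also have "\<dots> = 2 powr p * max (norm a) (norm b) powr p"
    by (simp add: powr_mult)
  also have "\<dots> \<le> 2 powr p * (norm a powr p + norm b powr p)"
    by (intro mult_left_mono) (auto simp: max_def)
  finally show ?thesis .
qed

lemma torus_Lp_add:
  fixes f g :: "real ^ 'n::finite \<Rightarrow> complex"
  assumes f: "f \<in> torus_Lp p" and g: "g \<in> torus_Lp p" and p: "0 \<le> p"
  shows "(\<lambda>x. f x + g x) \<in> torus_Lp p"
    and "(LINT x|torus_measure. norm (f x + g x) powr p) \<le>
           2 powr p * ((LINT x|torus_measure. norm (f x) powr p) + (LINT x|torus_measure. norm (g x) powr p))"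
proof -
  have int: "integrable torus_measure (\<lambda>x. 2 powr p * (norm (f x) powr p + norm (g x) powr p))"
    using f g by (auto simp: torus_Lp_def)
  have le: "norm (f x + g x) powr p \<le> 2 powr p * (norm (f x) powr p + norm (g x) powr p)" for x
    by (rule norm_add_powr_le[OF p])
  have [measurable]: "f \<in> borel_measurable torus_measure" "g \<in> borel_measurable torus_measure"
    using f g by (auto simp: torus_Lp_def)
  have int': "integrable torus_measure (\<lambda>x. norm (f x + g x) powr p)"
  proof (rule Bochner_Integration.integrable_bound[OF int])
    show "AE x in torus_measure. norm (norm (f x + g x) powr p) \<le>
        norm (2 powr p * (norm (f x) powr p + norm (g x) powr p))"
    proof (rule AE_I2)
      show "norm (norm (f x + g x) powr p) \<le> norm (2 powr p * (norm (f x) powr p + norm (g x) powr p))" for x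
        using le[of x] by simp
    qed
  qed measurable
  then show "(\<lambda>x. f x + g x) \<in> torus_Lp p"
    using f g by (auto simp: torus_Lp_def torus_periodic_def)
  have "(LINT x|torus_measure. norm (f x + g x) powr p) \<le>
      (LINT x|torus_measure. 2 powr p * (norm (f x) powr p + norm (g x) powr p))"
    using int' int le by (rule integral_mono)
  also have "\<dots> = 2 powr p * ((LINT x|torus_measure. norm (f x) powr p) + (LINT x|torus_measure. norm (g x) powr p))"
    using f g by (simp add: torus_Lp_def)
  finally show "(LINT x|torus_measure. norm (f x + g x) powr p) \<le>
           2 powr p * ((LINT x|torus_measure. norm (f x) powr p) + (LINT x|torus_measure. norm (g x) powr p))" .
qed

lemma torus_Lp_uminus: "f \<in> torus_Lp p \<Longrightarrow> (\<lambda>x. - f x) \<in> torus_Lp p"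
  by (auto simp: torus_Lp_def torus_periodic_def)

lemma torus_Lp_diff:
  fixes f g :: "real ^ 'n::finite \<Rightarrow> complex"
  assumes "f \<in> torus_Lp p" "g \<in> torus_Lp p" "0 \<le> p"
  shows "(\<lambda>x. f x - g x) \<in> torus_Lp p"
  using torus_Lp_add(1)[OF assms(1) torus_Lp_uminus[OF assms(2)] assms(3)] by simp

section \<open>Smoothing contracts \<open>L\<^sup>p\<close>\<close>

lemma powr_ge_tangent:
  fixes a b p :: real
  assumes "1 \<le> p" "0 < a" "0 \<le> b"
  shows "a powr p + p * a powr (p - 1) * (b - a) \<le> b powr p"
proof (cases "b = 0")
  case True
  have "a powr (p - 1) * a = a powr p"
    using assms(2) by (simp add: powr_diff)
  moreover have "1 * a powr p \<le> p * a powr p"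
    using assms(1) by (intro mult_right_mono) auto
  ultimately show ?thesis using True by (simp add: algebra_simps)
next
  case False
  have "p * a powr (p - 1) * (b - a) \<le> b powr p - a powr p"
  proof (rule convex_on_imp_above_tangent[OF powr_convex[OF assms(1)]])
    show "((\<lambda>x. x powr p) has_field_derivative p * a powr (p - 1)) (at a within {0<..})"
      using assms(2) by (auto intro!: derivative_eq_intros)
  qed (use assms False in \<open>auto simp: interior_open\<close>)
  then show ?thesis by simp
qed

text \<open>
  Jensen's inequality for the power function and the probability density \<open>w\<close>, obtained by
  integrating the tangent inequality at the mean \<open>a\<close> against \<open>w\<close>.
\<close>

lemma integral_powr_le_weighted:
  fixes g w :: "'a \<Rightarrow> real"
  assumes p: "1 \<le> p" and g: "\<And>y. 0 \<le> g y" and w: "\<And>y. 0 \<le> w y"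
    and "integrable M w" "(LINT y|M. w y) = 1"
    and "integrable M (\<lambda>y. g y * w y)" "integrable M (\<lambda>y. g y powr p * w y)"
  shows "(LINT y|M. g y * w y) powr p \<le> (LINT y|M. g y powr p * w y)"
proof -
  define a where "a = (LINT y|M. g y * w y)"
  have "0 \<le> a"
    unfolding a_def using g w by (intro integral_nonneg_AE AE_I2 mult_nonneg_nonneg)
  show ?thesis
  proof (cases "a = 0")
    case True
    then show ?thesis
      using w by (auto simp: a_def[symmetric] intro!: integral_nonneg_AE)
  next
    case False
    with \<open>0 \<le> a\<close> have "0 < a" by simp
    define s where "s = p * a powr (p - 1)"
    have "a powr p = (LINT y|M. (a powr p - s * a) * w y + s * (g y * w y))"
      using assms by (simp add: a_def[symmetric])
    also have "\<dots> \<le> (LINT y|M. g y powr p * w y)"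
    proof (rule integral_mono)
      fix y
      have "(a powr p + s * (g y - a)) * w y \<le> g y powr p * w y"
        unfolding s_def using powr_ge_tangent[OF p \<open>0 < a\<close> g] w by (intro mult_right_mono)
      then show "(a powr p - s * a) * w y + s * (g y * w y) \<le> g y powr p * w y"
        by (simp add: algebra_simps)
    qed (use assms in auto)
    finally show ?thesis by (simp add: a_def)
  qed
qed

text \<open>
  Smoothing multiplies the Fourier coefficients of \<open>f\<close> by those of the kernel, of which finitely
  many are nonzero.
\<close>

lemma smoothing_expansion:
  fixes f :: "real ^ 'n::finite \<Rightarrow> complex"
  assumes f: "integrable torus_measure f"
    and expansion: "finite F" "\<And>z. complex_of_real (bump_kernel N z) = (\<Sum>k\<in>F. c k * character k z)"
    and "F \<subseteq> integer_lattice"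
  shows "smoothing N f x = (\<Sum>k\<in>F. (LINT y|torus_measure. f y * character (- k) y) * (c k * character k x))"
proof -
  have "f y * bump_kernel N (x - y) = (\<Sum>k\<in>F. f y * character (- k) y * (c k * character k x))" for y
    unfolding expansion(2) by (simp add: character_diff_right sum_distrib_left mult_ac)
  moreover have "integrable torus_measure (\<lambda>y. f y * character (- k) y)" if "k \<in> F" for k
    using that assms(4) character_torus_C[of "- k" 1]
    by (intro integrable_mult_torus_C f) (auto intro: integer_lattice_uminus)
  ultimately show ?thesis
    unfolding smoothing_def by (simp add: Bochner_Integration.integral_sum)
qed

lemma smoothing_torus_C:
  fixes f :: "real ^ 'n::finite \<Rightarrow> complex"
  assumes f: "integrable torus_measure f"
  shows "smoothing N f \<in> torus_C"
proof -
  obtain F c where F: "finite F" "F \<subseteq> integer_lattice"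
      and c: "(\<lambda>z. complex_of_real (bump_kernel N z)) = (\<lambda>z :: real ^ 'n. \<Sum>k\<in>F. c k * character k z)"
    using trig_poly_expansion[OF trig_poly_kernel] by metis
  have "smoothing N f = (\<lambda>x. \<Sum>k\<in>F. (LINT y|torus_measure. f y * character (- k) y) * c k * character k x)"
    using smoothing_expansion[OF f F(1) fun_cong[OF c] F(2)] by (auto simp: mult.assoc)
  also have "\<dots> \<in> torus_C"
    using F(2) by (intro torus_C_sum character_torus_C) auto
  finally show ?thesis .
qed

lemma smoothing_diff:
  assumes "integrable torus_measure f" "integrable torus_measure g"
  shows "smoothing N (\<lambda>x. f x - g x) x = smoothing N f x - smoothing N g x"
  using assms by (simp add: smoothing_def left_diff_distrib integrable_mult_torus_C kernel_torus_C)

lemma integral_kernel_convolution: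
  fixes h :: "real ^ 'n::finite \<Rightarrow> real"
  assumes h: "integrable torus_measure h"
  shows "integrable torus_measure (\<lambda>x. LINT y|torus_measure. h y * bump_kernel N (x - y))"
    and "(LINT x|torus_measure. LINT y|torus_measure. h y * bump_kernel N (x - y)) = (LINT y|torus_measure. h y)"
proof -
  have eq: "(LINT y|torus_measure. complex_of_real (h y) * complex_of_real (bump_kernel N (x - y))) =
      complex_of_real (LINT y|torus_measure. h y * bump_kernel N (x - y))" for x
    by (simp only: of_real_mult[symmetric] integral_complex_of_real)
  have h': "integrable torus_measure (\<lambda>x. complex_of_real (h x))"
    using h by (simp add: complex_of_real_integrable_eq)
  have "complex_of_real (LINT y|torus_measure. bump_kernel N (0 - y :: real ^ 'n)) =
      (LINT y|torus_measure. complex_of_real (bump_kernel N (y :: real ^ 'n)))"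
    using integral_trig_poly_reflect[OF trig_poly_kernel, of N 0] by (simp only: integral_complex_of_real)
  then have one: "(LINT y|torus_measure. complex_of_real (bump_kernel N (y :: real ^ 'n))) = 1"
    unfolding integral_kernel by simp
  note conv = integral_trig_poly_convolution[OF trig_poly_kernel[of N] h', unfolded eq one]
  show "integrable torus_measure (\<lambda>x. LINT y|torus_measure. h y * bump_kernel N (x - y))"
    using conv(1) by (simp only: complex_of_real_integrable_eq)
  show "(LINT x|torus_measure. LINT y|torus_measure. h y * bump_kernel N (x - y)) = (LINT y|torus_measure. h y)"
    using conv(2) by (simp only: integral_complex_of_real mult_1_right of_real_eq_iff)
qed

text \<open>
  By Jensen's inequality for the density \<open>y \<mapsto> bump_kernel N (x - y)\<close>, the function
  \<open>\<bar>smoothing N f\<bar>\<^sup>p\<close> lies below the smoothing of \<open>\<bar>f\<bar>\<^sup>p\<close>, which has the same integral as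
  \<open>\<bar>f\<bar>\<^sup>p\<close>.
\<close>

lemma smoothing_Lp_contraction:
  fixes f :: "real ^ 'n::finite \<Rightarrow> complex"
  assumes f: "f \<in> torus_Lp p" and p: "1 \<le> p"
  shows "(LINT x|torus_measure. norm (smoothing N f x) powr p) \<le> (LINT x|torus_measure. norm (f x) powr p)"
proof -
  have f': "integrable torus_measure f" by (rule torus_Lp_integrable[OF f p])
  have fp: "integrable torus_measure (\<lambda>x. norm (f x) powr p)"
    using f by (simp add: torus_Lp_def)
  have mult: "integrable torus_measure (\<lambda>y. h y * bump_kernel N (x - y))"
    if "integrable torus_measure h" for h :: "real ^ 'n \<Rightarrow> real" and x
  proof -
    have "integrable torus_measure (\<lambda>y. complex_of_real (h y) * complex_of_real (bump_kernel N (x - y)))"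
      using that by (intro integrable_mult_torus_C kernel_torus_C) (simp add: complex_of_real_integrable_eq)
    then show ?thesis
      by (simp only: of_real_mult[symmetric] complex_of_real_integrable_eq)
  qed
  have "norm (smoothing N f x) powr p \<le> (LINT y|torus_measure. norm (f y) powr p * bump_kernel N (x - y))" for x
  proof -
    have "norm (smoothing N f x) \<le> (LINT y|torus_measure. norm (f y * bump_kernel N (x - y)))"
      unfolding smoothing_def by (rule integral_norm_bound)
    also have "\<dots> = (LINT y|torus_measure. norm (f y) * bump_kernel N (x - y))"
      by (simp add: norm_mult abs_of_nonneg[OF kernel_nonneg])
    finally have "norm (smoothing N f x) powr p \<le> (LINT y|torus_measure. norm (f y) * bump_kernel N (x - y)) powr p"
      using p by (intro powr_mono2) auto
    also have "\<dots> \<le> (LINT y|torus_measure. norm (f y) powr p * bump_kernel N (x - y))"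
      using p f' fp by (intro integral_powr_le_weighted mult integrable_kernel integral_kernel kernel_nonneg) auto
    finally show ?thesis .
  qed
  then have "(LINT x|torus_measure. norm (smoothing N f x) powr p) \<le>
      (LINT x|torus_measure. LINT y|torus_measure. norm (f y) powr p * bump_kernel N (x - y))"
    using torus_C_subset_Lp[OF smoothing_torus_C[OF f'], of p] p integral_kernel_convolution(1)[OF fp]
    by (intro integral_mono) (auto simp: torus_Lp_def)
  also have "\<dots> = (LINT x|torus_measure. norm (f x) powr p)"
    by (rule integral_kernel_convolution(2)[OF fp])
  finally show ?thesis .
qed

section \<open>Density of the continuous functions in \<open>L\<^sup>p\<close>\<close>

text \<open>
  The radial projection of the plane onto the disc of radius \<open>M\<close>.
\<close>

definition clip :: "real \<Rightarrow> complex \<Rightarrow> complex" where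
  "clip M z = of_real (M / max M (norm z)) * z"

lemma clip_eq: "0 < M \<Longrightarrow> norm z \<le> M \<Longrightarrow> clip M z = z"
  by (simp add: clip_def)

lemma norm_clip_le:
  assumes "0 < M"
  shows "norm (clip M z) \<le> M"
proof -
  have "norm (clip M z) = M / max M (norm z) * norm z"
    using assms by (simp add: clip_def norm_mult del: of_real_divide)
  also have "\<dots> \<le> M / max M (norm z) * max M (norm z)"
    using assms by (intro mult_left_mono) auto
  also have "\<dots> = M"
    using assms by simp
  finally show ?thesis .
qed

lemma norm_clip_diff_le:
  assumes "0 < M"
  shows "norm (clip M z - z) \<le> norm z"
proof -
  have "clip M z - z = - (of_real (1 - M / max M (norm z)) * z)"
    by (simp add: clip_def algebra_simps)
  moreover have "0 \<le> M / max M (norm z)" "M / max M (norm z) \<le> 1"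
    using assms by (auto simp: field_simps)
  ultimately have "norm (clip M z - z) = (1 - M / max M (norm z)) * norm z"
    by (simp add: norm_mult del: of_real_diff)
  also have "\<dots> \<le> 1 * norm z"
    using \<open>0 \<le> M / max M (norm z)\<close> by (intro mult_right_mono) auto
  finally show ?thesis by simp
qed

lemma continuous_on_clip: "0 < M \<Longrightarrow> continuous_on UNIV (clip M)"
  unfolding clip_def by (intro continuous_intros) (auto simp: max_def)

definition fundamental_part :: "real ^ 'n::finite \<Rightarrow> real ^ 'n" where
  "fundamental_part x = (\<chi> i. frac (x $ i))"

text \<open>
  For \<open>m > 0\<close> this vanishes exactly on the walls of the lattice cubes, where
  \<open>fundamental_part\<close> jumps, and off the walls it increases to \<open>1\<close> with \<open>m\<close>.
\<close>

definition wall_cutoff :: "real \<Rightarrow> real ^ 'n::finite \<Rightarrow> real" where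
  "wall_cutoff m x = min 1 (m * (\<Prod>i\<in>UNIV. \<bar>sin (x $ i * pi)\<bar>))"

lemma continuous_on_wall_cutoff:
  "continuous_on UNIV (wall_cutoff m :: real ^ 'n::finite \<Rightarrow> real)"
  unfolding wall_cutoff_def by (intro continuous_intros)

lemma wall_cutoff_nonneg: "0 \<le> m \<Longrightarrow> 0 \<le> wall_cutoff m x"
  by (simp add: wall_cutoff_def prod_nonneg)

lemma wall_cutoff_on_wall: "x $ i \<in> \<int> \<Longrightarrow> wall_cutoff m (x :: real ^ 'n::finite) = 0"
  unfolding wall_cutoff_def by (subst prod_zero[of UNIV]) (auto simp: sin_times_pi_eq_0)

lemma wall_cutoff_add_lattice:
  assumes "v \<in> integer_lattice"
  shows "wall_cutoff m (x + v) = wall_cutoff m (x :: real ^ 'n::finite)"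
proof -
  have "\<bar>sin ((x + v) $ i * pi)\<bar> = \<bar>sin (x $ i * pi)\<bar>" for i
  proof -
    have "v $ i \<in> \<int>" using assms by (simp add: integer_lattice_def)
    then have s: "sin (v $ i * pi) = 0" by (simp add: sin_times_pi_eq_0)
    then have "\<bar>cos (v $ i * pi)\<bar> = 1"
      using sin_zero_abs_cos_one by blast
    then show ?thesis
      using s by (simp add: distrib_right sin_add abs_mult)
  qed
  then show ?thesis by (simp add: wall_cutoff_def)
qed

lemma tendsto_wall_cutoff:
  assumes "x \<in> box 0 (1 :: real ^ 'n::finite)"
  shows "(\<lambda>m. wall_cutoff (real m) x) \<longlonglongrightarrow> 1"
proof -
  define s where "s = (\<Prod>i\<in>UNIV. \<bar>sin (x $ i * pi)\<bar>)"
  have "sin (x $ i * pi) \<noteq> 0" for i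
  proof -
    have "0 < x $ i" "x $ i < 1" using assms by (auto simp: mem_box_cart)
    then have "0 < sin (x $ i * pi)" by (intro sin_gt_zero) auto
    then show ?thesis by simp
  qed
  then have "0 < s"
    unfolding s_def by (intro prod_pos) auto
  then have "\<forall>\<^sub>F m in sequentially. 1 / s \<le> real m"
    by (intro eventually_sequentiallyI[of "nat \<lceil>1 / s\<rceil>"]) linarith
  moreover have "wall_cutoff (real m) x = min 1 (real m * s)" for m
    by (simp add: wall_cutoff_def s_def)
  ultimately have "\<forall>\<^sub>F m in sequentially. wall_cutoff (real m) x = 1"
    by (elim eventually_mono) (use \<open>0 < s\<close> in \<open>simp add: field_simps\<close>)
  then show ?thesis by (rule tendsto_eventually)
qed

text \<open>
  Off the walls \<open>fundamental_part\<close> is continuous. Near a wall \<open>g \<circ> fundamental_part\<close> may jump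
  but stays bounded, and the cutoff sends the product to \<open>0\<close>.
\<close>

lemma periodized_torus_C:
  fixes g :: "real ^ 'n::finite \<Rightarrow> complex"
  assumes g: "continuous_on UNIV g" and m: "0 \<le> m"
  shows "(\<lambda>x. g (fundamental_part x) * wall_cutoff m x) \<in> torus_C"
proof -
  let ?h = "\<lambda>x. g (fundamental_part x) * wall_cutoff m x"
  have "?h (x + v) = ?h x" if v: "v \<in> integer_lattice" for x v
  proof -
    have "fundamental_part (x + v) = fundamental_part x"
      using v by (simp add: fundamental_part_def integer_lattice_def frac_add_int_right)
    then show ?thesis using v by (simp add: wall_cutoff_add_lattice)
  qed
  moreover have "isCont ?h x" for x
  proof (cases "\<exists>i. x $ i \<in> \<int>")
    case True
    have "compact (g ` cbox 0 1)"
      using g by (intro compact_continuous_image) (auto intro: continuous_on_subset)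
    then obtain B where B: "\<And>y. y \<in> cbox 0 1 \<Longrightarrow> norm (g y) \<le> B"
      using compact_imp_bounded[of "g ` cbox 0 1"] by (auto simp: bounded_iff)
    have "fundamental_part y \<in> cbox 0 1" for y :: "real ^ 'n"
      by (simp add: fundamental_part_def mem_box_cart less_imp_le[OF frac_lt_1])
    then have le: "norm (?h y) \<le> B * wall_cutoff m y" for y
      using B wall_cutoff_nonneg[OF m, of y] by (simp add: norm_mult mult_right_mono)
    have 0: "wall_cutoff m x = 0"
      using True wall_cutoff_on_wall by blast
    have "isCont (wall_cutoff m) x"
      using continuous_on_wall_cutoff[where 'n = 'n, of m] by (simp add: continuous_on_eq_continuous_at)
    then have "((\<lambda>y. B * wall_cutoff m y) \<longlongrightarrow> B * wall_cutoff m x) (at x)"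
      unfolding isCont_def by (rule tendsto_mult_left)
    then have "(?h \<longlongrightarrow> 0) (at x)"
      using le 0 by (intro Lim_null_comparison[of ?h "\<lambda>y. B * wall_cutoff m y"]) auto
    then show ?thesis
      using 0 by (simp add: isCont_def)
  next
    case False
    have "((\<lambda>y. frac (y $ i)) \<longlongrightarrow> frac (x $ i)) (at x)" for i
      unfolding frac_def using False
      by (intro tendsto_diff tendsto_of_int_floor tendsto_vec_nth tendsto_ident_at) auto
    then have "isCont fundamental_part x"
      unfolding isCont_def fundamental_part_def by (intro tendsto_vec_lambda) 
    moreover have "isCont g (fundamental_part x)" "isCont (wall_cutoff m) x"
      using g continuous_on_wall_cutoff[where 'n = 'n, of m] by (simp_all add: continuous_on_eq_continuous_at)
    ultimately show ?thesis
      by (intro continuous_mult isCont_o2[of _ fundamental_part g] continuous_of_real)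
  qed
  ultimately show ?thesis
    by (simp add: torus_C_def torus_periodic_def continuous_on_eq_continuous_at)
qed

text \<open>
  A measurable function is an a.e. limit of continuous functions on the whole space; restricting
  these to the unit cube and cutting them off at its walls makes them periodic. In the limit the
  cutoff is felt only on the walls, which are null.
\<close>

lemma torus_measurable_AE_limit:
  fixes f :: "real ^ 'n::finite \<Rightarrow> complex"
  assumes "f \<in> borel_measurable torus_measure"
  obtains h where "\<And>m. h m \<in> torus_C" and "AE x in torus_measure. (\<lambda>m. h m x) \<longlonglongrightarrow> f x"
proof -
  have "f measurable_on cbox 0 1"
    using assms by (subst measurable_on_iff_borel_measurable) (auto simp: torus_measure_def)
  then obtain N g where N: "negligible N" and g: "\<And>m. continuous_on UNIV (g m)"
      and lim: "\<And>x. x \<notin> N \<Longrightarrow> (\<lambda>m. g m x) \<longlonglongrightarrow> (if x \<in> cbox 0 1 then f x else 0)"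
    unfolding measurable_on_def by blast
  define h where "h m x = g m (fundamental_part x) * complex_of_real (wall_cutoff (real m) x)" for m :: nat and x
  have "h m \<in> torus_C" for m
    unfolding h_def by (rule periodized_torus_C[OF g]) simp
  moreover have "AE x in torus_measure. (\<lambda>m. h m x) \<longlonglongrightarrow> f x"
  proof -
    have "N \<union> (cbox 0 1 - box 0 1) \<in> null_sets lebesgue"
      using N negligible_frontier_interval[of 0 1]
      unfolding negligible_iff_null_sets by (rule null_sets.Un)
    then have "AE x in lebesgue. x \<notin> N \<union> (cbox 0 1 - box 0 1)"
      by (rule AE_not_in)
    then have "AE x in lebesgue. x \<in> cbox 0 1 \<longrightarrow> (\<lambda>m. h m x) \<longlonglongrightarrow> f x"
    proof eventually_elim
      case (elim x)
      show ?case
      proof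
        assume "x \<in> cbox 0 1"
        with elim have x: "x \<in> box 0 1" "x \<notin> N" by auto
        then have "fundamental_part x = x"
          by (auto simp: fundamental_part_def vec_eq_iff mem_box_cart frac_eq less_imp_le)
        moreover have "(\<lambda>m. g m x * complex_of_real (wall_cutoff (real m) x)) \<longlonglongrightarrow> f x * complex_of_real 1"
          using lim[OF x(2)] \<open>x \<in> cbox 0 1\<close> tendsto_wall_cutoff[OF x(1)]
          by (intro tendsto_mult tendsto_of_real) auto
        ultimately show "(\<lambda>m. h m x) \<longlonglongrightarrow> f x"
          by (simp add: h_def)
      qed
    qed
    then show ?thesis
      unfolding torus_measure_def by (subst AE_restrict_space_iff) auto
  qed
  ultimately show thesis by (rule that)
qed

lemma dominated_powr_tendsto_0:
  fixes u :: "nat \<Rightarrow> 'a \<Rightarrow> complex"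
  assumes p: "0 < p" and [measurable]: "\<And>m. u m \<in> borel_measurable M"
    and w: "integrable M w" "\<And>m x. norm (u m x) powr p \<le> w x"
    and lim: "AE x in M. (\<lambda>m. u m x) \<longlonglongrightarrow> 0"
  shows "(\<lambda>m. LINT x|M. norm (u m x) powr p) \<longlonglongrightarrow> 0"
proof -
  have "(\<lambda>m. LINT x|M. norm (u m x) powr p) \<longlonglongrightarrow> (LINT x|M. 0)"
  proof (rule integral_dominated_convergence[where w = w])
    show "AE x in M. (\<lambda>m. norm (u m x) powr p) \<longlonglongrightarrow> 0"
      using lim
    proof eventually_elim
      case (elim x)
      then show ?case
        using p by (intro tendsto_zero_powrI[of _ _ _ p] tendsto_norm_zero tendsto_const) auto
    qed
  qed (use w in auto)
  then show ?thesis by simp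
qed

text \<open>
  Both steps use dominated convergence: the truncations of \<open>f\<close> converge to \<open>f\<close>, dominated by
  \<open>\<bar>f\<bar>\<^sup>p\<close>, and each truncation is an a.e. limit of equally truncated continuous functions,
  dominated by a constant.
\<close>

lemma torus_C_dense_Lp:
  fixes f :: "real ^ 'n::finite \<Rightarrow> complex"
  assumes f: "f \<in> torus_Lp p" and p: "1 \<le> p" and "0 < \<epsilon>"
  obtains h where "h \<in> torus_C" and "(LINT x|torus_measure. norm (f x - h x) powr p) < \<epsilon>"
proof -
  interpret finite_measure "torus_measure :: (real ^ 'n) measure" by (rule finite_measure_torus)
  have [measurable]: "f \<in> borel_measurable torus_measure"
    using f by (simp add: torus_Lp_def)
  have clip_measurable [measurable]: "clip M \<in> borel_measurable borel" if "0 < M" for M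
    using that by (intro borel_measurable_continuous_onI continuous_on_clip)
  have clip_f [measurable]: "(\<lambda>x. clip M (f x)) \<in> borel_measurable torus_measure" if "0 < M" for M
    using measurable_compose[OF _ clip_measurable[OF that], of f torus_measure] by simp
  define \<eta> where "\<eta> = \<epsilon> / (2 * 2 powr p)"
  have "0 < \<eta>" using \<open>0 < \<epsilon>\<close> by (simp add: \<eta>_def)

  have "(\<lambda>M. LINT x|torus_measure. norm (f x - clip (real (Suc M)) (f x)) powr p) \<longlonglongrightarrow> 0"
  proof (rule dominated_powr_tendsto_0[where w = "\<lambda>x. norm (f x) powr p"])
    show "AE x in torus_measure. (\<lambda>M. f x - clip (real (Suc M)) (f x)) \<longlonglongrightarrow> 0"
    proof (rule AE_I2)
      fix x
      have "\<forall>\<^sub>F M in sequentially. norm (f x) \<le> real (Suc M)"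
        by (intro eventually_sequentiallyI[of "nat \<lceil>norm (f x)\<rceil>"]) linarith
      then have "\<forall>\<^sub>F M in sequentially. f x - clip (real (Suc M)) (f x) = 0"
        by eventually_elim (simp add: clip_eq)
      then show "(\<lambda>M. f x - clip (real (Suc M)) (f x)) \<longlonglongrightarrow> 0"
        by (rule tendsto_eventually)
    qed
    show "norm (f x - clip (real (Suc M)) (f x)) powr p \<le> norm (f x) powr p" for M x
      using norm_clip_diff_le[of "real (Suc M)" "f x"] p
      by (intro powr_mono2) (auto simp: norm_minus_commute)
    show "(\<lambda>x. f x - clip (real (Suc M)) (f x)) \<in> borel_measurable torus_measure" for M
      using clip_f[of "real (Suc M)"] by simp
  qed (use f p in \<open>auto simp: torus_Lp_def\<close>)
  then have "\<forall>\<^sub>F M in sequentially. (LINT x|torus_measure. norm (f x - clip (real (Suc M)) (f x)) powr p) < \<eta>"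
    using \<open>0 < \<eta>\<close> by (rule order_tendstoD(2))
  then obtain L where L: "(LINT x|torus_measure. norm (f x - clip (real (Suc L)) (f x)) powr p) < \<eta>"
    using eventually_happens'[OF sequentially_bot] by blast
  define M where "M = real (Suc L)"
  have M: "0 < M" "(LINT x|torus_measure. norm (f x - clip M (f x)) powr p) < \<eta>"
    using L by (simp_all add: M_def)

  obtain h where h: "\<And>m. h m \<in> torus_C" "AE x in torus_measure. (\<lambda>m. h m x) \<longlonglongrightarrow> f x"
    using torus_measurable_AE_limit[of f] by auto
  have clip_h: "(\<lambda>x. clip M (h m x)) \<in> torus_C" for m
  proof -
    have "continuous_on UNIV (\<lambda>x. clip M (h m x))"
      by (rule continuous_on_compose2[OF continuous_on_clip[OF M(1)]])
        (use h(1)[of m] in \<open>auto simp: torus_C_def\<close>)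
    then show ?thesis
      using h(1)[of m] by (simp add: torus_C_def torus_periodic_def)
  qed
  have "(\<lambda>m. LINT x|torus_measure. norm (clip M (f x) - clip M (h m x)) powr p) \<longlonglongrightarrow> 0"
  proof (rule dominated_powr_tendsto_0[where w = "\<lambda>_. (2 * M) powr p"])
    show "AE x in torus_measure. (\<lambda>m. clip M (f x) - clip M (h m x)) \<longlonglongrightarrow> 0"
      using h(2)
    proof eventually_elim
      case (elim x)
      have "isCont (clip M) (f x)"
        using continuous_on_clip[OF M(1)] by (simp add: continuous_on_eq_continuous_at)
      then have "(\<lambda>m. clip M (h m x)) \<longlonglongrightarrow> clip M (f x)"
        using elim by (rule isCont_tendsto_compose)
      then have "(\<lambda>m. clip M (f x) - clip M (h m x)) \<longlonglongrightarrow> clip M (f x) - clip M (f x)"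
        by (intro tendsto_diff tendsto_const)
      then show ?case by simp
    qed
    show "norm (clip M (f x) - clip M (h m x)) powr p \<le> (2 * M) powr p" for m x
    proof (rule powr_mono2)
      show "norm (clip M (f x) - clip M (h m x)) \<le> 2 * M"
        using norm_triangle_ineq4[of "clip M (f x)" "clip M (h m x)"]
          norm_clip_le[OF M(1), of "f x"] norm_clip_le[OF M(1), of "h m x"] by linarith
    qed (use p in auto)
    show "(\<lambda>x. clip M (f x) - clip M (h m x)) \<in> borel_measurable torus_measure" for m
      by (rule borel_measurable_diff[OF clip_f[OF M(1)] torus_C_measurable[OF clip_h]])
  qed (use p in auto)
  then have "\<forall>\<^sub>F m in sequentially. (LINT x|torus_measure. norm (clip M (f x) - clip M (h m x)) powr p) < \<eta>"
    using \<open>0 < \<eta>\<close> by (rule order_tendstoD(2))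
  then obtain m where m: "(LINT x|torus_measure. norm (clip M (f x) - clip M (h m x)) powr p) < \<eta>"
    using eventually_happens'[OF sequentially_bot] by blast

  have clip_f_Lp: "(\<lambda>x. clip M (f x)) \<in> torus_Lp p"
  proof -
    have "integrable torus_measure (\<lambda>x. norm (clip M (f x)) powr p)"
    proof (rule integrable_const_bound)
      show "AE x in torus_measure. norm (norm (clip M (f x)) powr p) \<le> M powr p"
        using norm_clip_le[OF M(1)] p by (intro AE_I2) (simp add: powr_mono2)
    qed (use clip_f[OF M(1)] in measurable)
    then show ?thesis
      using f clip_f[OF M(1)] by (simp add: torus_Lp_def torus_periodic_def)
  qed
  have clip_h_Lp: "(\<lambda>x. clip M (h m x)) \<in> torus_Lp p"
    using clip_h p by (intro torus_C_subset_Lp) auto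
  have "(LINT x|torus_measure. norm ((f x - clip M (f x)) + (clip M (f x) - clip M (h m x))) powr p) \<le>
      2 powr p * ((LINT x|torus_measure. norm (f x - clip M (f x)) powr p) +
                  (LINT x|torus_measure. norm (clip M (f x) - clip M (h m x)) powr p))"
    using p by (intro torus_Lp_add(2) torus_Lp_diff f clip_f_Lp clip_h_Lp) auto
  also have "\<dots> < 2 powr p * (\<eta> + \<eta>)"
    using M(2) m by (intro mult_strict_left_mono add_strict_mono) auto
  also have "\<dots> = \<epsilon>" by (simp add: \<eta>_def)
  finally have "(LINT x|torus_measure. norm (f x - clip M (h m x)) powr p) < \<epsilon>" by simp
  with clip_h show thesis by (rule that)
qed

section \<open>Smoothing in \<open>L\<^sup>p\<close>\<close>

text \<open>
  For a continuous \<open>g\<close> close to \<open>f\<close>, the error splits into \<open>smoothing N (f - g)\<close>, which the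
  contraction keeps small for all \<open>N\<close>, the uniformly small \<open>smoothing N g - g\<close>, and \<open>g - f\<close>.
\<close>

lemma smoothing_Lp_convergence:
  fixes f :: "real ^ 'n::finite \<Rightarrow> complex"
  assumes f: "f \<in> torus_Lp p" and p: "1 \<le> p"
  shows "(\<lambda>N. LINT x|torus_measure. norm (smoothing N f x - f x) powr p) \<longlonglongrightarrow> 0"
proof (rule order_tendstoI)
  fix a :: real assume "a < 0"
  have "0 \<le> (LINT x|torus_measure. norm (smoothing N f x - f x) powr p)" for N
    by (intro integral_nonneg_AE) auto
  with \<open>a < 0\<close> show "\<forall>\<^sub>F N in sequentially. a < (LINT x|torus_measure. norm (smoothing N f x - f x) powr p)"
    by (intro always_eventually allI) (rule less_le_trans)
next
  fix \<epsilon> :: real assume "0 < \<epsilon>"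
  \<comment> \<open>\<open>C\<close> is the constant of the quasi-triangle inequality. Using that inequality twice turns three
      errors of size \<open>\<eta>\<close> into at most \<open>C * (\<eta> + C * (\<eta> + \<eta>)) = \<epsilon>\<close>.\<close>
  define C where "C = (2::real) powr p"
  have "0 < C" by (simp add: C_def)
  define \<eta> where "\<eta> = \<epsilon> / (C + 2 * C * C)"
  have "0 < \<eta>" using \<open>0 < \<epsilon>\<close> \<open>0 < C\<close> by (simp add: \<eta>_def add_pos_pos)
  obtain g where g: "g \<in> torus_C" and fg: "(LINT x|torus_measure. norm (f x - g x) powr p) < \<eta>"
    using torus_C_dense_Lp[OF f p \<open>0 < \<eta>\<close>] by blast
  have gf: "(LINT x|torus_measure. norm (g x - f x) powr p) < \<eta>"
    using fg by (simp add: norm_minus_commute)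
  have g_Lp: "g \<in> torus_Lp p"
    using g p by (intro torus_C_subset_Lp) auto
  have f_int: "integrable torus_measure f" and g_int: "integrable torus_measure g"
    using torus_Lp_integrable[OF f p] integrable_torus_C[OF g] by auto
  have Lp: "smoothing N f \<in> torus_Lp p" "smoothing N g \<in> torus_Lp p" for N
    using smoothing_torus_C[OF f_int] smoothing_torus_C[OF g_int] p by (auto intro!: torus_C_subset_Lp)
  have "\<forall>\<^sub>F N in sequentially. \<forall>x\<in>UNIV. dist (smoothing N g x) (g x) < \<eta> powr (1 / p)"
    using \<open>0 < \<eta>\<close> by (intro uniform_limitD[OF smoothing_uniform_limit[OF g]]) simp
  then show "\<forall>\<^sub>F N in sequentially. (LINT x|torus_measure. norm (smoothing N f x - f x) powr p) < \<epsilon>"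
  proof eventually_elim
    case (elim N)
    interpret finite_measure "torus_measure :: (real ^ 'n) measure" by (rule finite_measure_torus)
    have "(LINT x|torus_measure. norm (smoothing N g x - g x) powr p) \<le> (LINT x|(torus_measure :: (real ^ 'n) measure). \<eta>)"
    proof (rule integral_mono)
      show "integrable torus_measure (\<lambda>x. norm (smoothing N g x - g x) powr p)"
        using torus_Lp_diff[OF Lp(2) g_Lp] p by (simp add: torus_Lp_def)
      fix x
      have "norm (smoothing N g x - g x) powr p \<le> (\<eta> powr (1 / p)) powr p"
        using elim p by (intro powr_mono2) (auto simp: dist_norm less_imp_le)
      then show "norm (smoothing N g x - g x) powr p \<le> \<eta>"
        using p \<open>0 < \<eta>\<close> by (simp add: powr_powr)
    qed simp
    then have smooth_g: "(LINT x|torus_measure. norm (smoothing N g x - g x) powr p) \<le> \<eta>"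
      by simp
    have "(LINT x|torus_measure. norm (smoothing N f x - smoothing N g x) powr p) =
        (LINT x|torus_measure. norm (smoothing N (\<lambda>x. f x - g x) x) powr p)"
      by (simp add: smoothing_diff[OF f_int g_int])
    also have "\<dots> \<le> (LINT x|torus_measure. norm (f x - g x) powr p)"
      using p by (intro smoothing_Lp_contraction torus_Lp_diff f g_Lp) auto
    finally have smooth_fg: "(LINT x|torus_measure. norm (smoothing N f x - smoothing N g x) powr p) < \<eta>"
      using fg by linarith
    have "(LINT x|torus_measure. norm ((smoothing N g x - g x) + (g x - f x)) powr p) \<le>
        C * ((LINT x|torus_measure. norm (smoothing N g x - g x) powr p) +
             (LINT x|torus_measure. norm (g x - f x) powr p))"
      unfolding C_def using p by (intro torus_Lp_add(2) torus_Lp_diff f g_Lp Lp) auto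
    also have "\<dots> \<le> C * (\<eta> + \<eta>)"
      using \<open>0 < C\<close> smooth_g gf by (intro mult_left_mono add_mono) auto
    finally have gf': "(LINT x|torus_measure. norm (smoothing N g x - f x) powr p) \<le> C * (\<eta> + \<eta>)"
      by simp
    have "(LINT x|torus_measure. norm ((smoothing N f x - smoothing N g x) + (smoothing N g x - f x)) powr p) \<le>
        C * ((LINT x|torus_measure. norm (smoothing N f x - smoothing N g x) powr p) +
             (LINT x|torus_measure. norm (smoothing N g x - f x) powr p))"
      unfolding C_def using p by (intro torus_Lp_add(2) torus_Lp_diff f g_Lp Lp) auto
    also have "\<dots> < C * (\<eta> + C * (\<eta> + \<eta>))"
      using \<open>0 < C\<close> smooth_fg gf' by (intro mult_strict_left_mono add_less_le_mono) auto
    also have "\<dots> = \<eta> * (C + 2 * C * C)"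
      by (simp add: algebra_simps)
    also have "\<dots> = \<epsilon>"
      using \<open>0 < C\<close> by (simp add: \<eta>_def add_pos_pos less_imp_neq[THEN not_sym])
    finally show ?case by simp
  qed
qed

lemma Lp_convergence_AE_subsequence:
  fixes u :: "nat \<Rightarrow> 'a \<Rightarrow> complex"
  assumes p: "0 < p" and "\<And>N. integrable M (\<lambda>x. norm (u N x - f x) powr p)"
    and "(\<lambda>N. LINT x|M. norm (u N x - f x) powr p) \<longlonglongrightarrow> 0"
  shows "\<exists>r :: nat \<Rightarrow> nat. strict_mono r \<and> (AE x in M. (\<lambda>j. u (r j) x) \<longlonglongrightarrow> f x)"
proof -
  obtain r :: "nat \<Rightarrow> nat" where r: "strict_mono r"
      and AE: "AE x in M. (\<lambda>j. norm (u (r j) x - f x) powr p) \<longlonglongrightarrow> 0"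
    using tendsto_L1_AE_subseq[of M "\<lambda>N x. norm (u N x - f x) powr p"] assms(2,3) by auto
  from AE have "AE x in M. (\<lambda>j. u (r j) x) \<longlonglongrightarrow> f x"
  proof eventually_elim
    case (elim x)
    have "(\<lambda>j. (norm (u (r j) x - f x) powr p) powr (1 / p)) \<longlonglongrightarrow> 0"
      using p by (intro tendsto_zero_powrI[OF elim tendsto_const]) auto
    then have "(\<lambda>j. norm (u (r j) x - f x)) \<longlonglongrightarrow> 0"
      using p by (simp add: powr_powr)
    then show ?case
      by (simp add: tendsto_norm_zero_iff LIM_zero_iff)
  qed
  with r show ?thesis by blast
qed

section \<open>Reconstruction from Radon data\<close>

text \<open>
  The smoothing at stage \<open>N\<close> is a combination of finitely many characters, weighted by Fourier
  coefficients of \<open>f\<close>. Reading each coefficient off the Radon data, at a frame orthogonal to its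
  frequency, gives a scheme that makes sense for arbitrary data and serves all function spaces
  containing the continuous functions at once.
\<close>

lemma smoothing_from_radon:
  assumes "d < CARD('n::finite)"
  obtains \<Phi> :: "'n radon_data \<Rightarrow> nat \<Rightarrow> real ^ 'n \<Rightarrow> complex"
  where "\<And>X. torus_C \<subseteq> X \<Longrightarrow> reconstruction_scheme d X \<Phi>"
    and "\<And>f N. integrable torus_measure f \<Longrightarrow> \<Phi> (radon d (distribution_of f)) N = smoothing N f"
proof -
  have "\<exists>F c. finite F \<and> F \<subseteq> integer_lattice \<and>
      (\<lambda>z. complex_of_real (bump_kernel N z)) = (\<lambda>z :: real ^ 'n. \<Sum>k\<in>F. c k * character k z)" for N
    using trig_poly_expansion[OF trig_poly_kernel] by metis
  then obtain F c where F: "\<And>N. finite (F N)" "\<And>N. F N \<subseteq> integer_lattice"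
      and c: "\<And>N. (\<lambda>z. complex_of_real (bump_kernel N z)) = (\<lambda>z :: real ^ 'n. \<Sum>k\<in>F N. c N k * character k z)"
    by metis
  have "\<exists>A. A \<in> lattice_frames d \<and> (\<forall>v\<in>A. k \<bullet> v = 0)" if "k \<in> integer_lattice" for k :: "real ^ 'n"
    using lattice_frame_orthogonal[OF that assms] by metis
  then obtain A where A: "\<And>k :: real ^ 'n. k \<in> integer_lattice \<Longrightarrow> A k \<in> lattice_frames d"
      "\<And>(k :: real ^ 'n) v. k \<in> integer_lattice \<Longrightarrow> v \<in> A k \<Longrightarrow> k \<bullet> v = 0"
    by metis
  define \<Phi> :: "'n radon_data \<Rightarrow> nat \<Rightarrow> real ^ 'n \<Rightarrow> complex"
    where "\<Phi> g N x = (\<Sum>k\<in>F N. g (A k) (character (- k)) * (c N k * character k x))" for g N x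
  show thesis
  proof
    fix X :: "(real ^ 'n \<Rightarrow> complex) set" assume X: "torus_C \<subseteq> X"
    show "reconstruction_scheme d X \<Phi>"
      unfolding reconstruction_scheme_def
    proof
      fix N
      define T where "T k = (A k, character (- k), \<lambda>x. c N k * character k x)" for k
      have "inj_on T (F N)"
      proof (rule inj_onI)
        fix k l assume "k \<in> F N" "l \<in> F N" "T k = T l"
        then have "- k = - l"
          using F(2)[of N] by (intro character_inject) (auto simp: T_def intro: integer_lattice_uminus)
        then show "k = l" by simp
      qed
      then have "\<Phi> g N x = (\<Sum>(A, \<eta>, \<phi>)\<in>T ` F N. g A \<eta> * \<phi> x)" for g x
        by (simp add: sum.reindex \<Phi>_def) (simp add: T_def)
      moreover have "T ` F N \<subseteq> lattice_frames d \<times> torus_test \<times> X"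
        using F(2)[of N] A(1) X character_torus_C character_torus_test integer_lattice_uminus
        by (fastforce simp: T_def)
      ultimately show "\<exists>S\<subseteq>lattice_frames d \<times> torus_test \<times> X. finite S \<and>
          (\<forall>g\<in>\<Pi>\<^sub>E A\<in>lattice_frames d. torus_distributions.
              \<Phi> g N = (\<lambda>x. \<Sum>(A, \<eta>, \<phi>)\<in>S. g A \<eta> * \<phi> x))"
        using F(1)[of N] by (intro exI[of _ "T ` F N"]) auto
    qed
  next
    fix f :: "real ^ 'n \<Rightarrow> complex" and N
    assume f: "integrable torus_measure f"
    have "radon d (distribution_of f) (A k) (character (- k)) = (LINT y|torus_measure. f y * character (- k) y)"
      if "k \<in> F N" for k
      using that F(2)[of N] A by (intro radon_distribution_character integer_lattice_uminus) auto
    then show "\<Phi> (radon d (distribution_of f)) N = smoothing N f"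
      by (intro ext) (simp add: \<Phi>_def smoothing_expansion[OF f F(1) fun_cong[OF c] F(2)])
  qed
qed

theorem theorem4:
  fixes d :: nat
  assumes "CARD('n::finite) \<ge> 2" and "1 \<le> d" and "d < CARD('n)"
  shows
    "(\<exists>\<Phi> :: 'n radon_data \<Rightarrow> nat \<Rightarrow> real ^ 'n \<Rightarrow> complex.
        reconstruction_scheme d torus_C \<Phi> \<and>
        (\<forall>f\<in>torus_C.
           (\<forall>N. \<Phi> (radon d (distribution_of f)) N \<in> torus_C) \<and>
           uniform_limit UNIV (\<Phi> (radon d (distribution_of f))) f sequentially \<and>
           (\<forall>x. (\<lambda>N. \<Phi> (radon d (distribution_of f)) N x) \<longlonglongrightarrow> f x))) \<and>
     (\<forall>p::real. p \<ge> 1 \<longrightarrow>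
        (\<exists>\<Phi> :: 'n radon_data \<Rightarrow> nat \<Rightarrow> real ^ 'n \<Rightarrow> complex.
           reconstruction_scheme d (torus_Lp p) \<Phi> \<and>
           (\<forall>f\<in>torus_Lp p.
              (\<forall>N. \<Phi> (radon d (distribution_of f)) N \<in> torus_Lp p) \<and>
              (\<lambda>N. LINT x|torus_measure.
                     norm (\<Phi> (radon d (distribution_of f)) N x - f x) powr p) \<longlonglongrightarrow> 0 \<and>
              (\<exists>r :: nat \<Rightarrow> nat. strict_mono r \<and>
                 (AE x in torus_measure.
                    (\<lambda>j. \<Phi> (radon d (distribution_of f)) (r j) x) \<longlonglongrightarrow> f x)))))"
proof -
  obtain \<Phi> :: "'n radon_data \<Rightarrow> nat \<Rightarrow> real ^ 'n \<Rightarrow> complex"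
    where scheme: "\<And>X. torus_C \<subseteq> X \<Longrightarrow> reconstruction_scheme d X \<Phi>"
      and eq: "\<And>f N. integrable torus_measure f \<Longrightarrow> \<Phi> (radon d (distribution_of f)) N = smoothing N f"
    using smoothing_from_radon[OF assms(3)] by blast
  show ?thesis
  proof (intro conjI allI impI)
    have "(\<forall>N. \<Phi> (radon d (distribution_of f)) N \<in> torus_C) \<and>
        uniform_limit UNIV (\<Phi> (radon d (distribution_of f))) f sequentially \<and>
        (\<forall>x. (\<lambda>N. \<Phi> (radon d (distribution_of f)) N x) \<longlonglongrightarrow> f x)" if f: "f \<in> torus_C" for f
    proof -
      have \<Phi>: "\<Phi> (radon d (distribution_of f)) = (\<lambda>N. smoothing N f)"
        using eq[OF integrable_torus_C[OF f]] by (intro ext) simp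
      show ?thesis
        unfolding \<Phi> using smoothing_uniform_limit[OF f] smoothing_torus_C[OF integrable_torus_C[OF f]]
        by (auto intro: tendsto_uniform_limitI)
    qed
    then show "\<exists>\<Phi> :: 'n radon_data \<Rightarrow> nat \<Rightarrow> real ^ 'n \<Rightarrow> complex.
        reconstruction_scheme d torus_C \<Phi> \<and>
        (\<forall>f\<in>torus_C.
           (\<forall>N. \<Phi> (radon d (distribution_of f)) N \<in> torus_C) \<and>
           uniform_limit UNIV (\<Phi> (radon d (distribution_of f))) f sequentially \<and>
           (\<forall>x. (\<lambda>N. \<Phi> (radon d (distribution_of f)) N x) \<longlonglongrightarrow> f x))"
      using scheme[OF order.refl] by blast
  next
    fix p :: real assume p: "1 \<le> p"
    have "(\<forall>N. \<Phi> (radon d (distribution_of f)) N \<in> torus_Lp p) \<and>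
        (\<lambda>N. LINT x|torus_measure. norm (\<Phi> (radon d (distribution_of f)) N x - f x) powr p) \<longlonglongrightarrow> 0 \<and>
        (\<exists>r :: nat \<Rightarrow> nat. strict_mono r \<and>
           (AE x in torus_measure. (\<lambda>j. \<Phi> (radon d (distribution_of f)) (r j) x) \<longlonglongrightarrow> f x))"
      if f: "f \<in> torus_Lp p" for f
    proof -
      have f_int: "integrable torus_measure f"
        by (rule torus_Lp_integrable[OF f p])
      have \<Phi>: "\<Phi> (radon d (distribution_of f)) = (\<lambda>N. smoothing N f)"
        using eq[OF f_int] by (intro ext) simp
      have Lp: "smoothing N f \<in> torus_Lp p" for N
        using smoothing_torus_C[OF f_int] p by (intro torus_C_subset_Lp) auto
      have lim: "(\<lambda>N. LINT x|torus_measure. norm (smoothing N f x - f x) powr p) \<longlonglongrightarrow> 0"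
        by (rule smoothing_Lp_convergence[OF f p])
      moreover have "integrable torus_measure (\<lambda>x. norm (smoothing N f x - f x) powr p)" for N
        using torus_Lp_diff[OF Lp f] p by (simp add: torus_Lp_def)
      ultimately show ?thesis
        unfolding \<Phi> using Lp p Lp_convergence_AE_subsequence[of p torus_measure "\<lambda>N. smoothing N f" f]
        by auto
    qed
    moreover have "reconstruction_scheme d (torus_Lp p) \<Phi>"
      using p by (intro scheme subsetI torus_C_subset_Lp) auto
    ultimately show "\<exists>\<Phi> :: 'n radon_data \<Rightarrow> nat \<Rightarrow> real ^ 'n \<Rightarrow> complex.
           reconstruction_scheme d (torus_Lp p) \<Phi> \<and>
           (\<forall>f\<in>torus_Lp p.
              (\<forall>N. \<Phi> (radon d (distribution_of f)) N \<in> torus_Lp p) \<and>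
              (\<lambda>N. LINT x|torus_measure.
                     norm (\<Phi> (radon d (distribution_of f)) N x - f x) powr p) \<longlonglongrightarrow> 0 \<and>
              (\<exists>r :: nat \<Rightarrow> nat. strict_mono r \<and>
                 (AE x in torus_measure.
                    (\<lambda>j. \<Phi> (radon d (distribution_of f)) (r j) x) \<longlonglongrightarrow> f x)))"
      by blast
  qed
qed

end
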